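(* Let $\mathcal{T}=(\mathcal{V},\mathcal{E})$ and $\mathcal{T}'=(\mathcal{V},\mathcal{E}')$ be two trees on the same set of $d$ vertices, and let $u,v,w\in\mathcal{V}$ with $(u,v)\in\mathcal{E}$, $(u,w)\in\mathcal{E}'$ be such that $\mathcal{E}\setminus\{(u,v)\}=\mathcal{E}'\setminus\{(u,w)\}$; that is, the only difference between the two trees is that $u$ is connected to $w$ in $\mathcal{T}'$ rather than to $v$ as in $\mathcal{T}$. Let $\lambda>0$ and let $\boldsymbol{\alpha}=(\alpha_e,e\in\mathcal{E})$, $\boldsymbol{\alpha}'=(\alpha'_e,e\in\mathcal{E}')$ in $[0,1]^{d-1}$ satisfy $\alpha_e=\alpha'_e$ for every $e\in\mathcal{E}\setminus\{(u,v)\}$ and $\alpha_{(u,v)}=\alpha'_{(u,w)}$. Let $\boldsymbol{N}\sim\mathrm{MPMRF}(\lambda,\boldsymbol{\alpha},\mathcal{T})$ and $\boldsymbol{N}'\sim\mathrm{MPMRF}(\lambda,\boldsymbol{\alpha}',\mathcal{T}')$, with $M=\sum_{j\in\mathcal{V}}N_j$ and $M'=\sum_{j\in\mathcal{V}}N'_j$. Let $\mathcal{V}^\dagger=\{u\}\cup\mathrm{dsc}(u)$ with descendants taken in $\mathcal{T}$ rooted at $v$ (equivalently, in $\mathcal{T}'$ rooted at $w$), let $\mathcal{E}^\dagger=\{(i,j)\in\mathcal{E}:i,j\in\mathcal{V}^\dagger\}$, and let $\tau^*=(\mathcal{V}^*,\mathcal{E}^* )$ be the residual subtree common to $\mathcal{T}$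 and $\mathcal{T}'$, with $\mathcal{V}^*=\mathcal{V}\setminus\mathcal{V}^\dagger$ and $\mathcal{E}^*=\mathcal{E}\setminus(\{(u,v)\}\cup\mathcal{E}^\dagger)=\mathcal{E}'\setminus(\{(u,w)\}\cup\mathcal{E}^\dagger)$, equipped with the parameters $(\alpha_e,e\in\mathcal{E}^* )$. Let $H_v^{\tau^*_v}$ and $H_w^{\tau^*_w}$ be discrete random variables with probability generating functions $t\mapsto\eta_v^{\tau^*_v}(t)$ and $t\mapsto\eta_w^{\tau^*_w}(t)$, $t\in[-1,1]$, respectively. If $H_v^{\tau^*_v}\preceq_{st}H_w^{\tau^*_w}$, then $M\preceq_{cx}M'$.
   Context: Trees and rootings. A tree $\mathcal{T}=(\mathcal{V},\mathcal{E})$ is a finite simple undirected graph in which any two vertices are joined by exactly one path; edges are undirected. For $r\in\mathcal{V}$, $\mathcal{T}_r$ is $\mathcal{T}$ rooted at $r$. In $\mathcal{T}_r$: $\mathrm{dsc}(v)$ is the set of vertices $u\neq v$ such that $v$ lies on the path from $u$ to $r$; $\mathrm{ch}(v)$ is the set of $j\in\mathrm{dsc}(v)$ with $(v,j)\in\mathcal{E}$; $\mathrm{pa}(v)$, for $v\ne r$, is the unique neighbour of $v$ that is not a child of $v$. The family MPMRF. For a count random variable $N$ and $\alpha\in[0,1]$, binomial thinning is $\alpha\circ N=\sum_{i=1}^{N}I_i^{(\alpha)}$ with $(I_i^{(\alpha)})_i$ i.i.d. Bernoulli($\alpha$), independent of $N$ (the empty sum is $0$); thinnings attached to different edges use independent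 Bernoulli variables. Given a tree $\mathcal{T}$, $\lambda>0$ and $\boldsymbol{\alpha}=(\alpha_e,e\in\mathcal{E})$, choose a root $r$ and let $(L_v,v\in\mathcal{V})$ be independent (and independent of all thinning variables) with $L_r\sim\mathrm{Poisson}(\lambda)$ and $L_v\sim\mathrm{Poisson}(\lambda(1-\alpha_{(\mathrm{pa}(v),v)}))$ for $v\neq r$, where $\mathrm{Poisson}(0)$ is the point mass at $0$. Set $N_r=L_r$ and $N_v=L_v+\alpha_{(\mathrm{pa}(v),v)}\circ N_{\mathrm{pa}(v)}$ for $v\ne r$, recursively down the tree. The law of $\boldsymbol{N}=(N_v,v\in\mathcal{V})$ does not depend on the chosen root; one writes $\boldsymbol{N}\sim\mathrm{MPMRF}(\lambda,\boldsymbol{\alpha},\mathcal{T})$. All marginals are $\mathrm{Poisson}(\lambda)$. The functions $\eta$. For a rooted tree $\tau_r$ with edge parameters $(\alpha_e)$, define recursively $\eta_v^{\tau_r}(t)=t\prod_{j\in\mathrm{ch}(v)}\bigl(1-\alpha_{(v,j)}+\alpha_{(v,j)}\,\eta_j^{\tau_r}(t)\bigr)$, with $\eta_v^{\tau_r}(t)=t$ if $\mathrm{ch}(v)=\emptyset$ (children taken in $\tau_r$). Each is the probability generating function of a discrete random variable. Orders. $X\preceq_{st}Y$ (usual stochastic order) means $\Pr(X>x)\le\Pr(Y>x)$ for all $x\in\mathbb{R}$. $X\preceq_{cx}Y$ (convex order) means $\mathrm{E}[\varphi(X)]\le\mathrm{E}[\varphi(Y)]$ for every convex function $\varphi$ for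 which the expectations exist. *)

theory Defs
  imports "HOL-Probability.Probability"
begin

section \<open>Trees and rootings\<close>

text \<open>Undirected edges are two-element vertex sets, so \<open>{i, j}\<close> stands for the edge
  between \<open>i\<close> and \<open>j\<close>; a path is the list of its vertices.\<close>

definition is_path :: "'v set \<Rightarrow> 'v set set \<Rightarrow> 'v \<Rightarrow> 'v list \<Rightarrow> 'v \<Rightarrow> bool" where
  "is_path V E x p y \<longleftrightarrow>
     p \<noteq> [] \<and> hd p = x \<and> last p = y \<and> set p \<subseteq> V \<and> distinct p \<and>
     successively (\<lambda>a b. {a, b} \<in> E) p"

definition is_tree :: "'v set \<Rightarrow> 'v set set \<Rightarrow> bool" where
  "is_tree V E \<longleftrightarrow>
     finite V \<and> (\<forall>e\<in>E. \<exists>a\<in>V. \<exists>b\<in>V. a \<noteq> b \<and> e = {a, b}) \<and>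
     (\<forall>x\<in>V. \<forall>y\<in>V. \<exists>!p. is_path V E x p y)"

text \<open>In the following three definitions the argument \<open>r\<close> is the root.\<close>

definition dsc :: "'v set \<Rightarrow> 'v set set \<Rightarrow> 'v \<Rightarrow> 'v \<Rightarrow> 'v set" where
  "dsc V E r v = {u \<in> V. u \<noteq> v \<and> (\<exists>p. is_path V E u p r \<and> v \<in> set p)}"

definition ch :: "'v set \<Rightarrow> 'v set set \<Rightarrow> 'v \<Rightarrow> 'v \<Rightarrow> 'v set" where
  "ch V E r v = {j \<in> dsc V E r v. {v, j} \<in> E}"

definition pa :: "'v set \<Rightarrow> 'v set set \<Rightarrow> 'v \<Rightarrow> 'v \<Rightarrow> 'v" where
  "pa V E r v = (THE i. i \<in> V \<and> {v, i} \<in> E \<and> i \<notin> ch V E r v)"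

lemma is_path_suffix:
  assumes "is_path V E x (ps @ j # qs) y"
  shows "is_path V E j (j # qs) y"
  using assms by (auto simp: is_path_def successively_append_iff)

lemma dsc_child_psubset:
  assumes tree: "is_tree V E" and j: "j \<in> ch V E r v"
  shows "dsc V E r j \<subset> dsc V E r v"
proof -
  from j obtain q where jV: "j \<in> V" and jv: "j \<noteq> v" and q: "is_path V E j q r" and vq: "v \<in> set q"
    by (auto simp: ch_def dsc_def)
  have rV: "r \<in> V" using q by (auto simp: is_path_def)
  have uniq: "q' = q" if "is_path V E j q' r" for q'
    using tree q that jV rV unfolding is_tree_def by blast
  have "x \<in> dsc V E r v" if x: "x \<in> dsc V E r j" for x
  proof -
    from x obtain p where xV: "x \<in> V" and p: "is_path V E x p r" and jp: "j \<in> set p"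
      and xj: "x \<noteq> j"
      by (auto simp: dsc_def)
    from jp obtain ps qs where p_eq: "p = ps @ j # qs" by (auto simp: in_set_conv_decomp)
    have q_eq: "j # qs = q" using is_path_suffix p p_eq uniq by metis
    have "x \<noteq> v"
    proof
      assume "x = v"
      moreover have "ps \<noteq> []" using p p_eq xj by (auto simp: is_path_def)
      ultimately have "v \<in> set ps" using p p_eq by (cases ps) (auto simp: is_path_def)
      then show False using p p_eq q_eq vq by (auto simp: is_path_def)
    qed
    moreover have "v \<in> set p" using p_eq q_eq vq by auto
    ultimately show ?thesis using xV p by (auto simp: dsc_def)
  qed
  moreover have "j \<in> dsc V E r v" using j by (simp add: ch_def)
  moreover have "j \<notin> dsc V E r j" by (simp add: dsc_def)
  ultimately show ?thesis by blast
qed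

section \<open>The functions eta\<close>

text \<open>The function \<open>\<eta>\<close> of the vertex \<open>v\<close> in the tree \<open>(V, E)\<close> rooted at \<open>r\<close>, with edge
  parameters \<open>a\<close>. The test \<open>is_tree V E\<close> only serves to make the recursion terminate; the
  value \<open>0\<close> for non-trees is a dummy.\<close>

function eta :: "'v set \<Rightarrow> 'v set set \<Rightarrow> ('v set \<Rightarrow> real) \<Rightarrow> 'v \<Rightarrow> 'v \<Rightarrow> real \<Rightarrow> real" where
  "eta V E a r v t =
     (if is_tree V E
      then t * (\<Prod>j\<in>ch V E r v. 1 - a {v, j} + a {v, j} * eta V E a r j t)
      else 0)"
  by pat_completeness auto
termination
proof (relation "Wellfounded.measure (\<lambda>(V, E, a, r, v, t). card (dsc V E r v))", goal_cases)
  case 1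
  show ?case by simp
next
  case (2 V E a r v t j)
  then have "finite (dsc V E r v)" by (auto simp: is_tree_def dsc_def)
  then have "card (dsc V E r j) < card (dsc V E r v)"
    using 2 by (intro psubset_card_mono dsc_child_psubset) auto
  then show ?case by simp
qed

declare eta.simps [simp del]

section \<open>The family MPMRF\<close>

text \<open>The library's \<open>poisson_pmf\<close> is specified for positive rates only.\<close>

definition poisson0_pmf :: "real \<Rightarrow> nat pmf" where
  "poisson0_pmf l = (if l = 0 then return_pmf 0 else poisson_pmf l)"

text \<open>Binomial thinning of the count \<open>n\<close> by means of the 0/1-valued sequence \<open>I\<close>.\<close>

definition thin :: "(nat \<Rightarrow> 'w \<Rightarrow> nat) \<Rightarrow> ('w \<Rightarrow> nat) \<Rightarrow> 'w \<Rightarrow> nat" where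
  "thin I n \<omega> = (\<Sum>i=1..n \<omega>. I i \<omega>)"

text \<open>The construction of \<open>N\<close> from the root \<open>r\<close>. The sequence \<open>I v\<close> performs
  the thinning along the edge between \<open>v\<close> and its parent; the \<open>L v\<close> and all \<open>I v i\<close> form
  one independent family.\<close>

definition mpmrf_construction ::
  "'w measure \<Rightarrow> 'v set \<Rightarrow> 'v set set \<Rightarrow> real \<Rightarrow> ('v set \<Rightarrow> real) \<Rightarrow> 'v \<Rightarrow>
   ('v \<Rightarrow> 'w \<Rightarrow> nat) \<Rightarrow> ('v \<Rightarrow> nat \<Rightarrow> 'w \<Rightarrow> nat) \<Rightarrow> ('v \<Rightarrow> 'w \<Rightarrow> nat) \<Rightarrow> bool" where
  "mpmrf_construction P V E l a r L I N \<longleftrightarrow>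
     prob_space P \<and>
     prob_space.indep_vars P (\<lambda>_. count_space UNIV) (case_sum L (\<lambda>(v, i). I v i))
       (V <+> (V - {r}) \<times> UNIV) \<and>
     distr P (count_space UNIV) (L r) = measure_pmf (poisson0_pmf l) \<and>
     (\<forall>v\<in>V - {r}.
        distr P (count_space UNIV) (L v) =
          measure_pmf (poisson0_pmf (l * (1 - a {pa V E r v, v}))) \<and>
        (\<forall>i. distr P (count_space UNIV) (I v i) =
          measure_pmf (map_pmf of_bool (bernoulli_pmf (a {pa V E r v, v}))))) \<and>
     (\<forall>\<omega>\<in>space P.
        N r \<omega> = L r \<omega> \<and>
        (\<forall>v\<in>V - {r}. N v \<omega> = L v \<omega> + thin (I v) (N (pa V E r v)) \<omega>))"

definition vector_law :: "'w measure \<Rightarrow> 'v set \<Rightarrow> ('v \<Rightarrow> 'w \<Rightarrow> nat) \<Rightarrow> ('v \<Rightarrow> nat) measure" where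
  "vector_law P V N = distr P (\<Pi>\<^sub>M v\<in>V. count_space UNIV) (\<lambda>\<omega>. \<lambda>v\<in>V. N v \<omega>)"

text \<open>\<open>is_MPMRF P V E l a N\<close>: the random vector \<open>N\<close> on \<open>P\<close> has the law of a vector
  constructed from some root. The construction may live on a space \<open>Q\<close> other
  than \<open>P\<close>. Its sample type costs no generality: it is that of the product space carrying one
  coordinate for each \<open>L v\<close> and each \<open>I v i\<close>.\<close>

definition is_MPMRF ::
  "'w measure \<Rightarrow> 'v set \<Rightarrow> 'v set set \<Rightarrow> real \<Rightarrow> ('v set \<Rightarrow> real) \<Rightarrow> ('v \<Rightarrow> 'w \<Rightarrow> nat) \<Rightarrow> bool" where
  "is_MPMRF P V E l a N \<longleftrightarrow>
     prob_space P \<and> (\<forall>v\<in>V. N v \<in> P \<rightarrow>\<^sub>M count_space UNIV) \<and>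
     (\<exists>r\<in>V. \<exists>(Q :: ('v + 'v \<times> nat \<Rightarrow> nat) measure) L I K.
        mpmrf_construction Q V E l a r L I K \<and> vector_law P V N = vector_law Q V K)"

section \<open>Generating functions and stochastic orders\<close>

definition has_pgf :: "'w measure \<Rightarrow> ('w \<Rightarrow> nat) \<Rightarrow> (real \<Rightarrow> real) \<Rightarrow> bool" where
  "has_pgf P X g \<longleftrightarrow>
     prob_space P \<and> X \<in> P \<rightarrow>\<^sub>M count_space UNIV \<and>
     (\<forall>t\<in>{-1..1}. prob_space.expectation P (\<lambda>\<omega>. t ^ X \<omega>) = g t)"

definition st_le :: "'a measure \<Rightarrow> ('a \<Rightarrow> real) \<Rightarrow> 'b measure \<Rightarrow> ('b \<Rightarrow> real) \<Rightarrow> bool" where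
  "st_le P X Q Y \<longleftrightarrow>
     (\<forall>x. measure P {\<omega> \<in> space P. X \<omega> > x} \<le> measure Q {\<omega> \<in> space Q. Y \<omega> > x})"

definition cx_le :: "'a measure \<Rightarrow> ('a \<Rightarrow> real) \<Rightarrow> 'b measure \<Rightarrow> ('b \<Rightarrow> real) \<Rightarrow> bool" where
  "cx_le P X Q Y \<longleftrightarrow>
     (\<forall>\<phi> :: real \<Rightarrow> real. convex_on UNIV \<phi> \<longrightarrow>
        integrable P (\<lambda>\<omega>. \<phi> (X \<omega>)) \<longrightarrow> integrable Q (\<lambda>\<omega>. \<phi> (Y \<omega>)) \<longrightarrow>
        (\<integral>\<omega>. \<phi> (X \<omega>) \<partial>P) \<le> (\<integral>\<omega>. \<phi> (Y \<omega>) \<partial>Q))"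

end

theory Submission
  imports Defs
begin

text \<open>Keep every edge \<open>e\<close> of a tree independently with probability \<open>a e\<close>. The vertices then
fall into clusters, and the expected value \<open>\<Phi>(t)\<close> of the sum of \<open>t ^ |C|\<close> over all clusters
\<open>C\<close> is \<open>cluster_gf\<close>: in the tree rooted at \<open>r\<close>, the cluster of \<open>r\<close> contributes
\<open>\<eta>\<^sub>r(t)\<close>, and a vertex \<open>j\<close> below \<open>i\<close> is the topmost vertex of its cluster with
probability \<open>1 - a {i, j}\<close> and then contributes \<open>\<eta>\<^sub>j(t)\<close>. The counts \<open>N\<^sub>v\<close> are
obtained by dropping a Poisson number of individuals at each vertex and letting each of them spread
downwards along kept edges, so the total \<open>M\<close> has the generating function
\<open>exp(l (\<Phi>(t) - \<Phi>(1)))\<close> (lemma \<open>MPMRF_total_law\<close>). In other words, \<open>M\<close> is compound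
Poisson, and its jumps have the law of cluster sizes, with generating function
\<open>\<Phi>(t) / \<Phi>(1)\<close>.

If a tree arises from two trees by adding an edge with parameter \<open>\<alpha>\<close>, and \<open>x\<close>, \<open>y\<close> are
the functions \<open>\<eta>\<close> of the two endpoints in their own trees, then with probability \<open>\<alpha>\<close> the two
clusters at the endpoints merge, whence
\<open>\<Phi> = \<Phi>\<^sub>1 + \<Phi>\<^sub>2 + \<alpha> (x y - x - y)\<close> (lemma \<open>cluster_gf_joined\<close>). This formula is
symmetric in the endpoints, so \<open>\<Phi>\<close> does not depend on the root. It also applies to both trees
of the theorem, with the same two parts, and yields
\<open>\<Phi>' - \<Phi> = \<alpha> (y - 1) (\<eta>\<^sub>w - \<eta>\<^sub>v)\<close>. If \<open>Y\<close> is the size of the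
cluster of \<open>u\<close> in the moved branch, this says that the jump law changes by trading the pair of
jumps \<open>Y + H\<^sub>v\<close>, \<open>H\<^sub>w\<close> for the pair \<open>Y + H\<^sub>w\<close>, \<open>H\<^sub>v\<close>. Since \<open>H\<^sub>v\<close> is
stochastically below \<open>H\<^sub>w\<close>, the second pair is more spread out and has the same sum, so the
jump law increases in the convex order (lemmas \<open>expectation_conv_swap\<close> and
\<open>stop_loss_le_pgf_swap\<close>); the order passes to convolution powers and to Poisson mixtures of them
(lemma \<open>stop_loss_le_compound_poisson\<close>).

The convex order is treated as the comparison of all expectations of \<open>(k - n)\<^sup>+\<close> for natural
\<open>k\<close>, together with equality of the means (lemma \<open>convex_expectation_le\<close>). These test
functions are bounded, so no integrability has to be carried through the argument until the means
enter at the end.\<close>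

section \<open>Probability generating functions of count distributions\<close>

lemma expectation_bind_pmf:
  fixes f :: "'b \<Rightarrow> real"
  assumes "\<And>y. \<bar>f y\<bar> \<le> B"
  shows "measure_pmf.expectation (bind_pmf p g) f
    = measure_pmf.expectation p (\<lambda>x. measure_pmf.expectation (g x) f)"
  unfolding measure_pmf_bind
  by (rule integral_bind[where K = "count_space UNIV" and B' = 1 and B = B])
    (use assms in \<open>auto simp: measure_pmf.finite_measure_axioms measure_subprob measure_pmf.emeasure_space_1\<close>)

lemma integrable_pmf_bounded:
  fixes f :: "'a \<Rightarrow> real"
  assumes "\<And>x. \<bar>f x\<bar> \<le> B"
  shows "integrable (measure_pmf p) f"
  using assms by (intro measure_pmf.integrable_const_bound[where B = B]) auto

lemma expectation_bounded:
  fixes f :: "'a \<Rightarrow> real"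
  assumes "\<And>x. \<bar>f x\<bar> \<le> B"
  shows "\<bar>measure_pmf.expectation p f\<bar> \<le> B"
proof -
  have "0 \<le> B" using assms[of undefined] by simp
  have "\<bar>measure_pmf.expectation p f\<bar> \<le> measure_pmf.expectation p (\<lambda>x. \<bar>f x\<bar>)" by simp
  also have "\<dots> \<le> measure_pmf.expectation p (\<lambda>_. B)"
    by (intro integral_mono integrable_pmf_bounded[where B = B]) (use assms \<open>0 \<le> B\<close> in auto)
  finally show ?thesis by simp
qed

definition pgf :: "nat pmf \<Rightarrow> real \<Rightarrow> real" where
  "pgf p t = measure_pmf.expectation p (\<lambda>n. t ^ n)"

lemma abs_power_le_1: "\<bar>t ^ n\<bar> \<le> 1" if "t \<in> {-1..1}" for t :: real
  using that by (auto simp: power_abs abs_le_iff intro!: power_le_one)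

lemma pgf_1 [simp]: "pgf p 1 = 1"
  by (simp add: pgf_def)

lemma pgf_bounded: "t \<in> {-1..1} \<Longrightarrow> pgf p t \<in> {-1..1}"
  using expectation_bounded[of "\<lambda>n. t ^ n" 1 p, OF abs_power_le_1] by (auto simp: pgf_def abs_le_iff)

lemma expectation_nat_sums:
  fixes f :: "nat \<Rightarrow> real"
  assumes "\<And>n. \<bar>f n\<bar> \<le> B"
  shows "(\<lambda>n. pmf p n * f n) sums measure_pmf.expectation p f"
proof -
  have e: "measure_pmf p = density (count_space UNIV) (\<lambda>n. ennreal (pmf p n))"
    by (rule measure_pmf_eq_density)
  have "integrable (measure_pmf p) f"
    by (rule integrable_pmf_bounded) fact
  then have i: "integrable (count_space UNIV) (\<lambda>n. pmf p n * f n)"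
    unfolding e by (subst (asm) integrable_real_density) auto
  have "measure_pmf.expectation p f = (\<integral>n. pmf p n * f n \<partial>count_space UNIV)"
    unfolding e by (subst integral_real_density) auto
  with sums_integral_count_space_nat[OF i] show ?thesis by simp
qed

lemma pgf_sums: "t \<in> {-1..1} \<Longrightarrow> (\<lambda>n. pmf p n * t ^ n) sums pgf p t"
  unfolding pgf_def by (rule expectation_nat_sums[where B = 1]) (rule abs_power_le_1)

text \<open>Once the first \<open>n\<close> coefficients vanish, the series divided by \<open>t ^ n\<close> is still zero for
\<open>t \<noteq> 0\<close>, and letting \<open>t\<close> tend to 0 isolates the next coefficient.\<close>

lemma powser_eq_0:
  fixes c :: "nat \<Rightarrow> real"
  assumes "\<And>t. t \<in> {-1..1} \<Longrightarrow> (\<lambda>n. c n * t ^ n) sums 0"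
  shows "c n = 0"
proof (induction n rule: less_induct)
  case (less n)
  have "(\<lambda>k. c (k + n) * t ^ k) sums 0" if t: "t \<noteq> 0" "norm t < 1" for t
  proof -
    have "(\<lambda>k. c k * t ^ k) sums 0" using t by (intro assms) auto
    then have "(\<lambda>k. c (k + n) * t ^ (k + n)) sums 0"
      using less sums_zero_iff_shift[of n "\<lambda>k. c k * t ^ k" 0] by auto
    then have "(\<lambda>k. (c (k + n) * t ^ (k + n)) / t ^ n) sums (0 / t ^ n)"
      by (rule sums_divide)
    then show ?thesis using t by (simp add: power_add)
  qed
  then have "((\<lambda>_. 0) \<longlongrightarrow> c (0 + n)) (at (0::real))"
    by (intro powser_limit_0_strong[where s = 1]) auto
  then show ?case by (simp add: tendsto_const_iff)
qed

lemma pmf_eq_pgfI: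
  assumes "\<And>t. t \<in> {-1..1} \<Longrightarrow> pgf p t = pgf q t"
  shows "p = q"
proof (rule pmf_eqI)
  fix n
  have "pmf p n - pmf q n = 0"
  proof (rule powser_eq_0[where c = "\<lambda>n. pmf p n - pmf q n"])
    fix t :: real assume t: "t \<in> {-1..1}"
    show "(\<lambda>n. (pmf p n - pmf q n) * t ^ n) sums 0"
      using sums_diff[OF pgf_sums[OF t, of p] pgf_sums[OF t, of q]] assms[OF t]
      by (simp add: left_diff_distrib)
  qed
  then show "pmf p n = pmf q n" by simp
qed

definition conv :: "nat pmf \<Rightarrow> nat pmf \<Rightarrow> nat pmf" where
  "conv p q = bind_pmf p (\<lambda>m. map_pmf (\<lambda>n. m + n) q)"

primrec conv_pow :: "nat pmf \<Rightarrow> nat \<Rightarrow> nat pmf" where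
  "conv_pow p 0 = return_pmf 0"
| "conv_pow p (Suc k) = conv p (conv_pow p k)"

lemma expectation_conv:
  fixes f :: "nat \<Rightarrow> real"
  assumes "\<And>n. \<bar>f n\<bar> \<le> B"
  shows "measure_pmf.expectation (conv p q) f
    = measure_pmf.expectation p (\<lambda>m. measure_pmf.expectation q (\<lambda>n. f (m + n)))"
  unfolding conv_def by (subst expectation_bind_pmf[where B = B]) (use assms in auto)

lemma pgf_conv: "t \<in> {-1..1} \<Longrightarrow> pgf (conv p q) t = pgf p t * pgf q t"
  unfolding pgf_def by (subst expectation_conv[where B = 1])
    (auto simp: abs_power_le_1 power_add)

lemma pgf_conv_pow: "t \<in> {-1..1} \<Longrightarrow> pgf (conv_pow p k) t = pgf p t ^ k"
  by (induction k) (simp_all add: pgf_conv, simp add: pgf_def)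

lemma pgf_return: "pgf (return_pmf n) t = t ^ n"
  by (simp add: pgf_def)

lemma pgf_bernoulli:
  "\<alpha> \<in> {0..1} \<Longrightarrow> pgf (map_pmf of_bool (bernoulli_pmf \<alpha>)) t = 1 - \<alpha> + \<alpha> * t"
  by (simp add: pgf_def)

lemma expectation_poisson:
  assumes "0 \<le> l" "s \<in> {-1..1}"
  shows "measure_pmf.expectation (poisson0_pmf l) (\<lambda>n. s ^ n) = exp (l * (s - 1))"
proof (cases "l = 0")
  case False
  with assms have l: "0 < l" by simp
  have "(\<lambda>n. exp (- l) * ((l * s) ^ n /\<^sub>R fact n)) sums (exp (- l) * exp (l * s))"
    by (intro sums_mult exp_converges)
  moreover have "(\<lambda>n. pmf (poisson0_pmf l) n * s ^ n) sums pgf (poisson0_pmf l) s"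
    by (rule pgf_sums) fact
  moreover have "(\<lambda>n. exp (- l) * ((l * s) ^ n /\<^sub>R fact n)) = (\<lambda>n. pmf (poisson0_pmf l) n * s ^ n)"
    using l by (auto simp: poisson0_pmf_def field_simps power_mult_distrib)
  ultimately have "pgf (poisson0_pmf l) s = exp (- l) * exp (l * s)"
    using sums_unique2 by metis
  then show ?thesis by (simp add: pgf_def exp_add[symmetric] algebra_simps)
qed (simp add: poisson0_pmf_def)

lemma pgf_poisson: "0 \<le> l \<Longrightarrow> t \<in> {-1..1} \<Longrightarrow> pgf (poisson0_pmf l) t = exp (l * (t - 1))"
  by (simp add: pgf_def expectation_poisson)

definition compound_poisson :: "real \<Rightarrow> nat pmf \<Rightarrow> nat pmf" where
  "compound_poisson l p = bind_pmf (poisson0_pmf l) (conv_pow p)"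

lemma pgf_compound_poisson:
  assumes "0 \<le> l" "t \<in> {-1..1}"
  shows "pgf (compound_poisson l p) t = exp (l * (pgf p t - 1))"
proof -
  have "pgf (compound_poisson l p) t
      = measure_pmf.expectation (poisson0_pmf l) (\<lambda>m. pgf (conv_pow p m) t)"
    unfolding pgf_def compound_poisson_def
    by (rule expectation_bind_pmf[where B = 1]) (use assms abs_power_le_1 in auto)
  also have "\<dots> = measure_pmf.expectation (poisson0_pmf l) (\<lambda>m. pgf p t ^ m)"
    using assms by (simp add: pgf_conv_pow)
  finally show ?thesis using expectation_poisson assms pgf_bounded by simp
qed

definition mix :: "real \<Rightarrow> nat pmf \<Rightarrow> nat pmf \<Rightarrow> nat pmf" where
  "mix c p q = bind_pmf (bernoulli_pmf c) (\<lambda>b. if b then p else q)"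

lemma pgf_mix:
  assumes "c \<in> {0..1}" "t \<in> {-1..1}"
  shows "pgf (mix c p q) t = c * pgf p t + (1 - c) * pgf q t"
proof -
  have "pgf (mix c p q) t
      = measure_pmf.expectation (bernoulli_pmf c) (\<lambda>b. pgf (if b then p else q) t)"
    unfolding pgf_def mix_def
    by (rule expectation_bind_pmf[where B = 1]) (use assms abs_power_le_1 in auto)
  then show ?thesis using assms by (simp add: algebra_simps)
qed

section \<open>Multiples of generating functions\<close>

text \<open>Multiples of generating functions are closed under sums and products without any normalisation,
which makes it possible to recognise the functions \<open>\<eta>\<close> and the cluster-size function from
their defining expressions alone.\<close>

definition pgf_cone :: "(real \<Rightarrow> real) set" where
  "pgf_cone = {g. \<exists>c p. 0 \<le> c \<and> (\<forall>t\<in>{-1..1}. g t = c * pgf p t)}"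

lemma pgf_coneD: "g \<in> pgf_cone \<Longrightarrow> \<exists>p. \<forall>t\<in>{-1..1}. g t = g 1 * pgf p t"
  by (fastforce simp: pgf_cone_def)

lemma pgf_cone_const: "0 \<le> c \<Longrightarrow> (\<lambda>_. c) \<in> pgf_cone"
  unfolding pgf_cone_def by (auto intro!: exI[of _ c] exI[of _ "return_pmf 0"] simp: pgf_return)

lemma pgf_cone_id: "(\<lambda>t. t) \<in> pgf_cone"
  unfolding pgf_cone_def by (auto intro!: exI[of _ "1::real"] exI[of _ "return_pmf 1"] simp: pgf_return)

lemma pgf_cone_mult:
  assumes "f \<in> pgf_cone" "g \<in> pgf_cone"
  shows "(\<lambda>t. f t * g t) \<in> pgf_cone"
proof -
  from assms obtain c p d q where "0 \<le> c" "0 \<le> d" "\<forall>t\<in>{-1..1}. f t = c * pgf p t"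
    "\<forall>t\<in>{-1..1}. g t = d * pgf q t" by (auto simp: pgf_cone_def)
  then have "0 \<le> c * d \<and> (\<forall>t\<in>{-1..1}. f t * g t = c * d * pgf (conv p q) t)"
    by (auto simp: pgf_conv)
  then show ?thesis unfolding pgf_cone_def by blast
qed

lemma pgf_cone_add:
  assumes "f \<in> pgf_cone" "g \<in> pgf_cone"
  shows "(\<lambda>t. f t + g t) \<in> pgf_cone"
proof -
  from assms obtain c p d q where cd: "0 \<le> c" "0 \<le> d" and f: "\<forall>t\<in>{-1..1}. f t = c * pgf p t"
    and g: "\<forall>t\<in>{-1..1}. g t = d * pgf q t" by (auto simp: pgf_cone_def)
  show ?thesis
  proof (cases "c + d = 0")
    case True
    with cd have "c = 0" "d = 0" by auto
    with f g have "0 \<le> (0::real) \<and> (\<forall>t\<in>{-1..1}. f t + g t = 0 * pgf p t)" by auto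
    then show ?thesis unfolding pgf_cone_def by blast
  next
    case False
    with cd have pos: "0 < c + d" by simp
    have "f t + g t = (c + d) * pgf (mix (c / (c + d)) p q) t" if t: "t \<in> {-1..1}" for t
    proof -
      have "c / (c + d) \<in> {0..1}" using cd pos by auto
      with t have "(c + d) * pgf (mix (c / (c + d)) p q) t
          = (c + d) * (c / (c + d)) * pgf p t + (c + d) * (1 - c / (c + d)) * pgf q t"
        by (simp add: pgf_mix distrib_left mult.assoc)
      moreover have "(c + d) * (c / (c + d)) = c" "(c + d) * (1 - c / (c + d)) = d"
        using pos by (auto simp: field_simps)
      ultimately show ?thesis using f g t by simp
    qed
    with pos have "0 \<le> c + d \<and> (\<forall>t\<in>{-1..1}. f t + g t = (c + d) * pgf (mix (c / (c + d)) p q) t)"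
      by simp
    then show ?thesis unfolding pgf_cone_def by blast
  qed
qed

lemma pgf_cone_sum: "(\<And>i. i \<in> S \<Longrightarrow> f i \<in> pgf_cone) \<Longrightarrow> (\<lambda>t. \<Sum>i\<in>S. f i t) \<in> pgf_cone"
  by (induction S rule: infinite_finite_induct) (auto intro: pgf_cone_const pgf_cone_add)

lemma pgf_cone_prod: "(\<And>i. i \<in> S \<Longrightarrow> f i \<in> pgf_cone) \<Longrightarrow> (\<lambda>t. \<Prod>i\<in>S. f i t) \<in> pgf_cone"
  by (induction S rule: infinite_finite_induct) (auto intro: pgf_cone_const pgf_cone_mult)

section \<open>The lower stop-loss order\<close>

text \<open>The subtraction is that of the natural numbers, so the test functions are \<open>(k - n)\<^sup>+\<close>. They
are bounded, and \<open>(k - (m + n))\<^sup>+\<close> is the test function for \<open>(k - m)\<^sup>+\<close> at \<open>n\<close>,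
which is why the order is compatible with convolution.\<close>

definition stop_loss_le :: "nat pmf \<Rightarrow> nat pmf \<Rightarrow> bool" where
  "stop_loss_le p q \<longleftrightarrow> (\<forall>k::nat. measure_pmf.expectation p (\<lambda>n. real (k - n))
     \<le> measure_pmf.expectation q (\<lambda>n. real (k - n)))"

lemma stop_loss_le_refl: "stop_loss_le p p" by (simp add: stop_loss_le_def)

lemma stop_loss_le_bind:
  assumes "\<And>x. stop_loss_le (f x) (g x)"
  shows "stop_loss_le (bind_pmf p f) (bind_pmf p g)"
  unfolding stop_loss_le_def
proof
  fix k :: nat
  have "\<bar>measure_pmf.expectation q (\<lambda>n. real (k - n))\<bar> \<le> real k" for q
    by (rule expectation_bounded) simp
  then show "measure_pmf.expectation (bind_pmf p f) (\<lambda>n. real (k - n))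
     \<le> measure_pmf.expectation (bind_pmf p g) (\<lambda>n. real (k - n))"
    using assms
    by (simp add: expectation_bind_pmf[where B = "real k"] stop_loss_le_def
        integral_mono[OF integrable_pmf_bounded[where B = "real k"] integrable_pmf_bounded[where B = "real k"]])
qed

lemma stop_loss_le_shift: "stop_loss_le p q \<Longrightarrow> stop_loss_le (map_pmf (\<lambda>n. m + n) p) (map_pmf (\<lambda>n. m + n) q)"
  unfolding stop_loss_le_def by (simp flip: diff_diff_left)

lemma conv_commute: "conv p q = conv q p"
  by (rule pmf_eq_pgfI) (simp add: pgf_conv mult.commute)

lemma stop_loss_le_conv:
  assumes "stop_loss_le p p'" "stop_loss_le q q'"
  shows "stop_loss_le (conv p q) (conv p' q')"
proof -
  have right: "stop_loss_le (conv p q) (conv p q')" if "stop_loss_le q q'" for p q q'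
    unfolding conv_def by (intro stop_loss_le_bind stop_loss_le_shift that)
  have "stop_loss_le (conv p q) (conv p q')" using assms by (intro right)
  moreover have "stop_loss_le (conv p q') (conv p' q')"
    using right[OF assms(1), of q'] by (simp add: conv_commute)
  ultimately show ?thesis unfolding stop_loss_le_def by (meson order_trans)
qed

lemma stop_loss_le_conv_pow: "stop_loss_le p q \<Longrightarrow> stop_loss_le (conv_pow p m) (conv_pow q m)"
  by (induction m) (auto intro: stop_loss_le_refl stop_loss_le_conv)

lemma stop_loss_le_compound_poisson: "stop_loss_le p q \<Longrightarrow> stop_loss_le (compound_poisson l p) (compound_poisson l q)"
  unfolding compound_poisson_def by (intro stop_loss_le_bind stop_loss_le_conv_pow)

section \<open>Convex test functions\<close>

text \<open>A convex \<open>\<phi>\<close> is approximated from below by the functions \<open>g K\<close> that agree with \<open>\<phi>\<close> up to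
\<open>K\<close> and are continued beyond \<open>K\<close> with the slope of \<open>\<phi>\<close> between \<open>K\<close> and \<open>K + 1\<close>.
Each \<open>g K\<close> is an affine function, whose expectation only depends on the mean, plus a combination
of the functions \<open>(k - n)\<^sup>+\<close> with the second differences of \<open>\<phi>\<close> as coefficients. Since
\<open>g 0 \<le> g K \<le> \<phi>\<close> and \<open>g 0\<close> is affine, dominated convergence applies.\<close>

lemma convex_expectation_le:
  fixes \<phi> :: "real \<Rightarrow> real"
  assumes sl: "stop_loss_le p q"
    and int: "integrable p real" "integrable q real"
    and mean: "measure_pmf.expectation p real = measure_pmf.expectation q real"
    and convex: "convex_on UNIV \<phi>"
    and int_\<phi>: "integrable p (\<lambda>n. \<phi> (real n))" "integrable q (\<lambda>n. \<phi> (real n))"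
  shows "measure_pmf.expectation p (\<lambda>n. \<phi> (real n)) \<le> measure_pmf.expectation q (\<lambda>n. \<phi> (real n))"
proof -
  define f where "f n = \<phi> (real n)" for n
  define c where "c k = f (k + 2) - 2 * f (k + 1) + f k" for k
  define g where "g K n = f K + (f (K + 1) - f K) * (real n - real K)
      + (\<Sum>k<K. c k * real (Suc k - n))" for K n
  have c: "0 \<le> c k" for k
  proof -
    have mid: "(1 - 1/2) *\<^sub>R real k + (1/2) *\<^sub>R real (k + 2) = real (k + 1)" by (simp add: field_simps)
    have "\<phi> ((1 - 1/2) *\<^sub>R real k + (1/2) *\<^sub>R real (k + 2))
        \<le> (1 - 1/2) * \<phi> (real k) + (1/2) * \<phi> (real (k + 2))"
      by (rule convex_onD[OF convex]) auto
    then show ?thesis unfolding mid by (simp add: c_def f_def)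
  qed
  \<comment> \<open>Passing from \<open>K\<close> to \<open>K + 1\<close> bends the affine continuation upwards by the second difference.\<close>
  have step: "g (Suc K) n = g K n + c K * real (n - Suc K)" for K n
    by (cases "n \<le> Suc K") (auto simp: g_def c_def of_nat_diff algebra_simps)
  have mono: "incseq (\<lambda>K. g K n)" for n
    by (rule incseq_SucI) (use c in \<open>simp add: step\<close>)
  have shifted: "g (n + m) n = f n" for n m
  proof (induction m)
    case 0
    show ?case by (simp add: g_def)
  next
    case (Suc m)
    then show ?case by (simp add: step)
  qed
  have stable: "g K n = f n" if "n \<le> K" for K n using shifted[of n "K - n"] that by simp
  have lim: "(\<lambda>K. g K n) \<longlonglongrightarrow> f n" for n
    by (rule tendsto_eventually) (use stable in \<open>auto simp: eventually_sequentially\<close>)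
  have b: "integrable (measure_pmf r) (\<lambda>n. real (Suc k - n))" for r k
    by (rule integrable_pmf_bounded[where B = "real (Suc k)"]) simp
  have int_g: "integrable (measure_pmf r) (g K)" if "integrable (measure_pmf r) real" for r K
    unfolding g_def using that b
    by (intro Bochner_Integration.integrable_add Bochner_Integration.integrable_sum
        integrable_mult_right Bochner_Integration.integrable_diff) auto
  have dom: "norm (g K n) \<le> \<bar>g 0 n\<bar> + \<bar>f n\<bar>" for K n
  proof -
    have "g 0 n \<le> g K n" using mono by (simp add: incseq_def)
    moreover have "g K n \<le> f n"
      using incseqD[OF mono, of K "max K n" n] stable[of n "max K n"] by simp
    ultimately show ?thesis by simp
  qed
  have conv: "(\<lambda>K. measure_pmf.expectation r (g K)) \<longlonglongrightarrow> measure_pmf.expectation r f"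
    if "integrable (measure_pmf r) real" "integrable (measure_pmf r) f" for r
    by (rule integral_dominated_convergence[where w = "\<lambda>n. \<bar>g 0 n\<bar> + \<bar>f n\<bar>"])
      (use that lim dom int_g in auto)
  have eg: "measure_pmf.expectation r (g K) = f K + (f (K + 1) - f K) * (measure_pmf.expectation r real - real K)
      + (\<Sum>k<K. c k * measure_pmf.expectation r (\<lambda>n. real (Suc k - n)))"
    if r: "integrable (measure_pmf r) real" for r K
    unfolding g_def using r b by (simp add: Bochner_Integration.integral_sum)
  have "measure_pmf.expectation p (g K) \<le> measure_pmf.expectation q (g K)" for K
    using sl c by (auto simp: eg int mean stop_loss_le_def intro!: sum_mono mult_left_mono)
  then show ?thesis
    using LIMSEQ_le[OF conv conv] int int_\<phi> unfolding f_def by blast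
qed

section \<open>Paths in trees\<close>

lemma is_path_ends: "is_path V E x p y \<Longrightarrow> x \<in> set p \<and> y \<in> set p \<and> x \<in> V \<and> y \<in> V \<and> set p \<subseteq> V"
  by (auto simp: is_path_def)

lemma is_path_Cons:
  "is_path V E x p y \<Longrightarrow> z \<in> V \<Longrightarrow> z \<notin> set p \<Longrightarrow> {z, x} \<in> E \<Longrightarrow> is_path V E z (z # p) y"
  by (cases p) (auto simp: is_path_def)

lemma is_path_snoc:
  "is_path V E x p y \<Longrightarrow> z \<in> V \<Longrightarrow> z \<notin> set p \<Longrightarrow> {y, z} \<in> E \<Longrightarrow> is_path V E x (p @ [z]) z"
  by (auto simp: is_path_def successively_append_iff)

lemma is_path_singleton: "is_path V E x [z] y \<longleftrightarrow> x = z \<and> y = z \<and> z \<in> V"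
  by (auto simp: is_path_def)

lemma is_path_split:
  assumes "is_path V E x p y" "z \<in> set p"
  obtains ps qs where "p = ps @ z # qs" "is_path V E z (z # qs) y"
  using assms is_path_suffix by (metis in_set_conv_decomp)

lemma tree_path_unique:
  assumes "is_tree V E" "is_path V E x p y" "is_path V E x q y"
  shows "p = q"
  using assms is_path_ends[OF assms(2)] unfolding is_tree_def by blast

lemma tree_path_exists: "is_tree V E \<Longrightarrow> x \<in> V \<Longrightarrow> y \<in> V \<Longrightarrow> \<exists>p. is_path V E x p y"
  unfolding is_tree_def by blast

lemma tree_finite: "is_tree V E \<Longrightarrow> finite V"
  by (simp add: is_tree_def)

lemma tree_edge: "is_tree V E \<Longrightarrow> {x, y} \<in> E \<Longrightarrow> x \<in> V \<and> y \<in> V \<and> x \<noteq> y"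
  unfolding is_tree_def by (metis doubleton_eq_iff)

lemma dsc_subset: "dsc V E r v \<subseteq> V"
  by (auto simp: dsc_def)

lemma ch_subset: "ch V E r v \<subseteq> V"
  using dsc_subset by (fastforce simp: ch_def)

lemma finite_ch: "is_tree V E \<Longrightarrow> finite (ch V E r v)"
  using ch_subset tree_finite finite_subset by metis

lemma root_notin_dsc:
  assumes "is_tree V E" "v \<noteq> r"
  shows "r \<notin> dsc V E r v"
proof
  assume "r \<in> dsc V E r v"
  then obtain p where p: "is_path V E r p r" "v \<in> set p" "r \<in> V" by (auto simp: dsc_def)
  then have "p = [r]" using tree_path_unique[OF assms(1)] is_path_singleton by metis
  with p assms show False by simp
qed

lemma dsc_root:
  assumes "is_tree W F" "r \<in> W"
  shows "dsc W F r r = W - {r}"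
  using tree_path_exists[OF assms(1)] assms(2) is_path_ends unfolding dsc_def by fast

lemma tree_induct [consumes 1]:
  assumes "is_tree V E" "\<And>v. (\<And>j. j \<in> ch V E r v \<Longrightarrow> P j) \<Longrightarrow> P v"
  shows "P v"
proof (induction "card (dsc V E r v)" arbitrary: v rule: less_induct)
  case less
  have "finite (dsc V E r v)" for v
    using dsc_subset tree_finite[OF assms(1)] finite_subset by metis
  then have "card (dsc V E r j) < card (dsc V E r v)" if "j \<in> ch V E r v" for j
    using dsc_child_psubset[OF assms(1) that] by (intro psubset_card_mono)
  then show ?case using less assms(2) by blast
qed

text \<open>The parent of \<open>j\<close> is the second vertex on the path from \<open>j\<close> to the root; every other neighbour
of \<open>j\<close> reaches the root through \<open>j\<close>, because prepending \<open>j\<close> to a path avoiding it would give a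
second path from \<open>j\<close> to the root.\<close>

lemma parent_child:
  assumes tree: "is_tree V E" and r: "r \<in> V" and j: "j \<in> V" "j \<noteq> r"
  shows "j \<in> ch V E r i \<longleftrightarrow> i = pa V E r j" and "pa V E r j \<in> V"
proof -
  obtain p where p: "is_path V E j p r" using tree_path_exists[OF tree] j r by blast
  then obtain p' where p': "p = j # p'" by (cases p) (auto simp: is_path_def)
  then have "p' \<noteq> []" using p j by (auto simp: is_path_def)
  then obtain i0 rest where p_eq: "p = j # i0 # rest" using p' by (cases p') auto
  have sub: "is_path V E i0 (i0 # rest) r"
    using p is_path_suffix[of V E j "[j]" i0 rest r] by (simp add: p_eq)
  have j_notin: "j \<notin> set (i0 # rest)" and ji0: "{j, i0} \<in> E"
    using p by (auto simp: p_eq is_path_def)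
  have not_child: "k \<notin> ch V E r j" if k: "k \<in> set (i0 # rest)" for k
  proof
    assume "k \<in> ch V E r j"
    then obtain q where q: "is_path V E k q r" "j \<in> set q" by (auto simp: ch_def dsc_def)
    obtain ps qs where "i0 # rest = ps @ k # qs" "is_path V E k (k # qs) r"
      using is_path_split[OF sub k] .
    with q tree_path_unique[OF tree] have "set q \<subseteq> set (i0 # rest)"
      by (metis Un_iff set_append subsetI)
    with q j_notin show False by blast
  qed
  have uniq: "k = i0" if k: "k \<in> V" "{j, k} \<in> E" "k \<notin> ch V E r j" for k
  proof -
    obtain q where q: "is_path V E k q r" using tree_path_exists[OF tree] k(1) r by blast
    have "k \<noteq> j" using tree_edge[OF tree k(2)] by blast
    then have "j \<notin> set q" using k q by (auto simp: ch_def dsc_def)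
    then have "is_path V E j (j # q) r" using is_path_Cons[OF q j(1)] k(2) by blast
    from tree_path_unique[OF tree p this] have "q = i0 # rest" unfolding p_eq by simp
    then show ?thesis using q by (simp add: is_path_def)
  qed
  have i0V: "i0 \<in> V" using sub is_path_ends by metis
  have "i0 \<notin> ch V E r j" by (rule not_child) simp
  with i0V ji0 uniq have pa_eq: "pa V E r j = i0"
    unfolding pa_def by (intro the_equality) blast+
  then show "pa V E r j \<in> V" using i0V by simp
  have "j \<in> ch V E r i0"
    using j p p_eq ji0 j_notin by (auto simp: ch_def dsc_def insert_commute)
  moreover have "i = i0" if ch: "j \<in> ch V E r i"
  proof -
    from ch obtain p' where p': "is_path V E j p' r" and i: "i \<in> set p'" "i \<noteq> j" "{i, j} \<in> E"
      by (auto simp: ch_def dsc_def)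
    from tree_path_unique[OF tree p p'] i have "i \<in> set (i0 # rest)" using p_eq by auto
    moreover from this have "i \<in> V" using is_path_ends[OF sub] by blast
    ultimately show ?thesis using i(3) not_child by (intro uniq) (auto simp: insert_commute)
  qed
  ultimately show "j \<in> ch V E r i \<longleftrightarrow> i = pa V E r j" using pa_eq by auto
qed

lemma ch_eq_parent:
  assumes tree: "is_tree V E" and r: "r \<in> V"
  shows "ch V E r i = {j \<in> V - {r}. pa V E r j = i}"
proof -
  have "j \<in> V - {r}" if "j \<in> ch V E r i" for j
  proof -
    have "j \<in> dsc V E r i" "j \<in> V" "j \<noteq> i" using that by (auto simp: ch_def dsc_def)
    then show ?thesis using root_notin_dsc[OF tree, of i r] by auto
  qed
  then show ?thesis using parent_child(1)[OF tree r, of _ i] by blast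
qed

lemma path_enters:
  assumes "successively (\<lambda>b c. {b, c} \<in> E) p" "p \<noteq> []" "hd p \<notin> A" "last p \<in> A"
    and "\<And>b c. {b, c} \<in> E \<Longrightarrow> b \<in> A \<Longrightarrow> c \<notin> A \<Longrightarrow> b = s"
  shows "s \<in> set p"
  using assms(1-4)
proof (induction p rule: induct_list012)
  case (3 x y zs)
  then show ?case using assms(5)[of y x] by (cases "y \<in> A") (auto simp: insert_commute)
qed auto

text \<open>A path that leaves \<open>A\<close> has to return through an edge at \<open>s\<close>, but it has already used \<open>s\<close>
when it left.\<close>

lemma path_confined:
  assumes "successively (\<lambda>b c. {b, c} \<in> E) p" "p \<noteq> []" "hd p \<in> A" "last p \<in> A" "distinct p"
    and cross: "\<And>b c. {b, c} \<in> E \<Longrightarrow> b \<in> A \<Longrightarrow> c \<notin> A \<Longrightarrow> b = s"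
  shows "set p \<subseteq> A"
  using assms(1-5)
proof (induction p rule: induct_list012)
  case (3 x y zs)
  show ?case
  proof (cases "y \<in> A")
    case False
    then have "s \<in> set (y # zs)" using 3 path_enters[of E "y # zs" A s] cross by auto
    moreover have "x = s" using cross[of x y] 3 False by auto
    ultimately show ?thesis using 3 by auto
  qed (use 3 in auto)
qed auto

lemma path_induced:
  assumes p: "is_path V E x p y" and "x \<in> A" "y \<in> A"
    and cross: "\<And>b c. {b, c} \<in> E \<Longrightarrow> b \<in> A \<Longrightarrow> c \<notin> A \<Longrightarrow> b = s"
    and induced: "\<And>b c. {b, c} \<in> E \<Longrightarrow> b \<in> A \<Longrightarrow> c \<in> A \<Longrightarrow> {b, c} \<in> E'"
  shows "is_path A E' x p y"
proof -
  have sub: "set p \<subseteq> A" using assms path_confined[of E p A s] by (auto simp: is_path_def)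
  have "successively (\<lambda>b c. {b, c} \<in> E) p" using p by (simp add: is_path_def)
  then have "successively (\<lambda>b c. {b, c} \<in> E') p"
    by (rule successively_mono) (use sub induced in blast)
  with sub show ?thesis using p by (auto simp: is_path_def)
qed

lemma is_path_mono:
  assumes "is_path A E' x p y" "A \<subseteq> V" "E' \<subseteq> E"
  shows "is_path V E x p y"
  using assms successively_mono[of "\<lambda>b c. {b, c} \<in> E'" p "\<lambda>b c. {b, c} \<in> E"] by (auto simp: is_path_def)

section \<open>Two trees joined by an edge\<close>

text \<open>The edge between \<open>r\<close> and \<open>s\<close> is the only connection between the two parts. That the whole is a
tree is an assumption because it is known in both applications. With \<open>r\<close> as the root, every
vertex has the same children as in its own part, rooted at \<open>r\<close> or at \<open>s\<close>, except that \<open>r\<close>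
gains the child \<open>s\<close>.\<close>

locale joined_trees =
  fixes V1 V2 V :: "'v set" and E1 E2 E :: "'v set set" and r s :: 'v
  assumes tree: "is_tree V E" and tree1: "is_tree V1 E1" and tree2: "is_tree V2 E2"
    and disj: "V1 \<inter> V2 = {}" and r: "r \<in> V1" and s: "s \<in> V2"
    and V: "V = V1 \<union> V2" and E: "E = insert {r, s} (E1 \<union> E2)"
begin

text \<open>The two parts play symmetric roles; this provides each statement about the part of \<open>s\<close> also for
the part of \<open>r\<close>, and the independence of the root later on.\<close>

lemma swap: "joined_trees V2 V1 V E2 E1 E s r"
  using tree tree1 tree2 disj r s V E by unfold_locales (auto simp: insert_commute)

lemma crossing:
  assumes "{b, c} \<in> E" "b \<in> V2" "c \<notin> V2"
  shows "b = s" "c = r"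
proof -
  have "{b, c} \<notin> E1" "{b, c} \<notin> E2"
    using tree_edge[OF tree1] tree_edge[OF tree2] disj assms by blast+
  then have "{b, c} = {r, s}" using assms unfolding E by auto
  moreover have "b \<noteq> r" using assms disj r by auto
  ultimately show "b = s" "c = r" by (auto simp: doubleton_eq_iff)
qed

lemma inner_edge: "b \<in> V2 \<Longrightarrow> c \<in> V2 \<Longrightarrow> {b, c} \<in> E \<longleftrightarrow> {b, c} \<in> E2"
  using tree_edge[OF tree1] disj r unfolding E by (fastforce simp: doubleton_eq_iff)

lemma path_within:
  assumes "x \<in> V2" "y \<in> V2"
  shows "is_path V E x p y \<longleftrightarrow> is_path V2 E2 x p y"
proof
  assume "is_path V E x p y"
  then show "is_path V2 E2 x p y"
    by (rule path_induced[where s = s]) (use assms crossing inner_edge in auto)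
next
  assume "is_path V2 E2 x p y"
  then show "is_path V E x p y" by (rule is_path_mono) (auto simp: V E)
qed

lemma path_across:
  assumes "x \<in> V2"
  shows "is_path V E x p r \<longleftrightarrow> (\<exists>q. p = q @ [r] \<and> is_path V2 E2 x q s)"
proof -
  have ext: "is_path V E x (q @ [r]) r" if "is_path V2 E2 x q s" for q
  proof (rule is_path_snoc)
    show "is_path V E x q s" using that path_within assms s by simp
    show "r \<notin> set q" using that r disj is_path_ends by fast
  qed (use V E r in \<open>auto simp: insert_commute\<close>)
  obtain q where q: "is_path V2 E2 x q s" using tree_path_exists[OF tree2] assms s by blast
  have "p = q @ [r]" if "is_path V E x p r"
    using tree_path_unique[OF tree that ext[OF q]] .
  with q ext show ?thesis by blast
qed

lemma dsc_far: "v \<in> V2 \<Longrightarrow> dsc V E r v = dsc V2 E2 s v"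
proof -
  assume v: "v \<in> V2"
  have "v \<notin> set p" if "x \<in> V1" "is_path V E x p r" for x p
  proof -
    have "is_path V1 E1 x p r" using joined_trees.path_within[OF swap] that r by simp
    then show ?thesis using v disj is_path_ends by fast
  qed
  moreover have "v \<noteq> r" using v r disj by auto
  ultimately have "(\<exists>p. is_path V E x p r \<and> v \<in> set p)
      \<longleftrightarrow> x \<in> V2 \<and> (\<exists>p. is_path V2 E2 x p s \<and> v \<in> set p)" if "x \<in> V" for x
    using path_across[of x] that unfolding V by (cases "x \<in> V2") auto
  then show ?thesis unfolding dsc_def by (auto simp: V)
qed

lemma ch_far: "v \<in> V2 \<Longrightarrow> ch V E r v = ch V2 E2 s v"
  using dsc_subset[of V2 E2 s v] by (auto simp: ch_def dsc_far inner_edge)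

lemma dsc_near:
  assumes v: "v \<in> V1" "v \<noteq> r"
  shows "dsc V E r v = dsc V1 E1 r v"
proof -
  have "v \<notin> set p" if "x \<in> V2" "is_path V E x p r" for x p
  proof -
    from that have "\<exists>q. p = q @ [r] \<and> is_path V2 E2 x q s" using path_across by blast
    then show ?thesis using v disj is_path_ends by fastforce
  qed
  then show ?thesis
    unfolding dsc_def using joined_trees.path_within[OF swap _ r] v by (auto simp: V)
qed

lemma inner_edge1: "b \<in> V1 \<Longrightarrow> c \<in> V1 \<Longrightarrow> {b, c} \<in> E \<longleftrightarrow> {b, c} \<in> E1"
  using joined_trees.inner_edge[OF swap] .

lemma ch_near: "v \<in> V1 \<Longrightarrow> v \<noteq> r \<Longrightarrow> ch V E r v = ch V1 E1 r v"
  using dsc_subset[of V1 E1 r v] by (auto simp: ch_def dsc_near inner_edge1)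

lemma ch_root: "ch V E r r = insert s (ch V1 E1 r r)"
proof -
  have "j \<in> V - {r} \<and> {r, j} \<in> E \<longleftrightarrow> j = s \<or> j \<in> V1 - {r} \<and> {r, j} \<in> E1" for j
  proof (cases "j \<in> V2")
    case True
    then have "{r, j} \<in> E \<Longrightarrow> j = s"
      using crossing(1)[of j r] r disj by (auto simp: insert_commute)
    moreover have "{r, s} \<in> E" by (simp add: E)
    ultimately show ?thesis using True disj r by (auto simp: V)
  next
    case False
    then show ?thesis using inner_edge1[of r j] r s by (auto simp: V)
  qed
  moreover have "dsc V E r r = V - {r}" using dsc_root[OF tree] r by (simp add: V)
  ultimately show ?thesis
    unfolding ch_def using dsc_root[OF tree1 r] by auto
qed

lemma s_notin_ch: "s \<notin> ch V1 E1 r r"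
  using ch_subset[of V1 E1 r r] s disj by auto

lemma eta_far:
  assumes "v \<in> V2"
  shows "eta V E a r v t = eta V2 E2 a s v t"
  using tree2 assms
proof (induction v rule: tree_induct[where r = s])
  case (1 v)
  show ?case
    unfolding eta.simps[of V E a r v] eta.simps[of V2 E2 a s v]
    using 1 ch_subset[of V2 E2 s v] tree tree2 by (auto simp: ch_far intro!: prod.cong)
qed

lemma eta_near:
  assumes "v \<in> V1" "v \<noteq> r"
  shows "eta V E a r v t = eta V1 E1 a r v t"
  using tree1 assms
proof (induction v rule: tree_induct[where r = r])
  case (1 v)
  have "j \<noteq> r" if "j \<in> ch V1 E1 r v" for j
    using that root_notin_dsc[OF tree1] 1 by (auto simp: ch_def)
  then show ?case
    unfolding eta.simps[of V E a r v] eta.simps[of V1 E1 a r v]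
    using 1 ch_subset[of V1 E1 r v] tree tree1 by (auto simp: ch_near intro!: prod.cong)
qed

lemma ch_root_near: "j \<in> ch V1 E1 r r \<Longrightarrow> j \<in> V1 \<and> j \<noteq> r"
  using ch_subset[of V1 E1 r r] by (auto simp: ch_def dsc_def)

lemma eta_root:
  "eta V E a r r t = eta V1 E1 a r r t * (1 - a {r, s} + a {r, s} * eta V2 E2 a s s t)"
  unfolding eta.simps[of V E a r r] eta.simps[of V1 E1 a r r]
  using tree tree1 finite_ch[OF tree1] ch_root_near s_notin_ch
  by (auto simp: ch_root eta_near eta_far s mult_ac intro!: prod.cong)

end

text \<open>If \<open>b\<close> lies below \<open>s\<close> and is adjacent to \<open>c\<close>, which does not, then \<open>c\<close> lies on the path from
\<open>b\<close> to the root, as otherwise \<open>c\<close> would reach the root through \<open>b\<close> and \<open>s\<close>. It cannot precede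
\<open>s\<close> there, and after \<open>s\<close> the path consists of \<open>r\<close> only. So \<open>{r, s}\<close> is the only edge
leaving the branch, and paths between two vertices on the same side stay on that side.\<close>

lemma cut_edge:
  assumes tree: "is_tree V E" and e: "{r, s} \<in> E"
  defines "V2 \<equiv> {s} \<union> dsc V E r s"
  defines "V1 \<equiv> V - V2"
  defines "E1 \<equiv> {e \<in> E. e \<subseteq> V1}" and "E2 \<equiv> {e \<in> E. e \<subseteq> V2}"
  shows "joined_trees V1 V2 V E1 E2 E r s"
proof -
  have rV: "r \<in> V" and sV: "s \<in> V" and rs: "r \<noteq> s" using tree_edge[OF tree e] by auto
  have sr: "is_path V E s [s, r] r"
    using e rs rV sV by (auto simp: is_path_def insert_commute)
  have V2: "x \<in> V2 \<longleftrightarrow> (\<exists>p. is_path V E x p r \<and> s \<in> set p)" for x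
    unfolding V2_def dsc_def using sr is_path_ends[of V E x _ r] by auto
  have rV2: "r \<notin> V2"
    using rs root_notin_dsc[OF tree, of s r] by (auto simp: V2_def)
  have cross: "b = s \<and> c = r" if bc: "{b, c} \<in> E" "b \<in> V2" "c \<notin> V2" for b c
  proof -
    have bcV: "b \<in> V" "c \<in> V" "b \<noteq> c" using tree_edge[OF tree bc(1)] by auto
    obtain p where p: "is_path V E b p r" and sp: "s \<in> set p" using bc V2 by blast
    obtain as bs where p_eq: "p = as @ s # bs" and "is_path V E s (s # bs) r"
      using is_path_split[OF p sp] .
    then have bs: "bs = [r]" using tree_path_unique[OF tree sr] by auto
    have "c \<in> set p"
    proof (rule ccontr)
      assume "c \<notin> set p"
      then have "is_path V E c (c # p) r"
        using is_path_Cons[OF p] bc bcV by (simp add: insert_commute)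
      then show False using bc V2 sp by (meson list.set_intros(2))
    qed
    moreover have "c \<notin> set as"
    proof
      assume "c \<in> set as"
      then obtain cs ds where "as = cs @ c # ds" by (auto simp: in_set_conv_decomp)
      then have "is_path V E c (c # ds @ s # bs) r"
        using p is_path_suffix[of V E b cs c "ds @ s # bs" r] by (simp add: p_eq)
      then show False using bc V2[of c] by force
    qed
    moreover have "c \<noteq> s" using bc V2_def by auto
    ultimately have c: "c = r" by (auto simp: p_eq bs)
    then have "is_path V E b [b, r] r" using bc bcV rV by (auto simp: is_path_def)
    then have "p = [b, r]" using tree_path_unique[OF tree p] by simp
    then show ?thesis using sp rs c by auto
  qed
  have V2V: "V2 \<subseteq> V" using dsc_subset[of V E r s] sV by (simp add: V2_def)
  have edges: "\<exists>b\<in>V. \<exists>c\<in>V. b \<noteq> c \<and> e = {b, c}" if "e \<in> E" for e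
    using tree that unfolding is_tree_def by blast
  have uniq_path: "\<exists>!p. is_path V E x p y" if "x \<in> V" "y \<in> V" for x y
    using tree that by (simp add: is_tree_def)
  have induced_tree: "is_tree A {e \<in> E. e \<subseteq> A}"
    if A: "A \<subseteq> V" and cr: "\<And>b c. {b, c} \<in> E \<Longrightarrow> b \<in> A \<Longrightarrow> c \<notin> A \<Longrightarrow> b = z" for A z
  proof -
    have "is_path V E x p y \<longleftrightarrow> is_path A {e \<in> E. e \<subseteq> A} x p y" if "x \<in> A" "y \<in> A" for x y p
    proof
      assume "is_path V E x p y"
      then show "is_path A {e \<in> E. e \<subseteq> A} x p y"
        by (rule path_induced[where s = z]) (use that in \<open>auto intro: cr\<close>)
    next
      assume "is_path A {e \<in> E. e \<subseteq> A} x p y"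
      then show "is_path V E x p y" by (rule is_path_mono) (use A in auto)
    qed
    moreover have "\<exists>!p. is_path V E x p y" if "x \<in> A" "y \<in> A" for x y
      using uniq_path A that by (simp add: subset_iff)
    ultimately have "\<exists>!p. is_path A {e \<in> E. e \<subseteq> A} x p y" if "x \<in> A" "y \<in> A" for x y
      using that by simp
    moreover have "\<exists>b\<in>A. \<exists>c\<in>A. b \<noteq> c \<and> e = {b, c}" if "e \<in> E" "e \<subseteq> A" for e
      using edges[OF that(1)] that(2) by auto
    moreover have "finite A" using A tree_finite[OF tree] finite_subset by blast
    ultimately show ?thesis unfolding is_tree_def by auto
  qed
  have "is_tree V2 E2" unfolding E2_def
    by (rule induced_tree[where z = s]) (use V2V cross in auto)
  moreover have "is_tree V1 E1" unfolding E1_def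
  proof (rule induced_tree[where z = r])
    fix b c assume bc: "{b, c} \<in> E" "b \<in> V1" "c \<notin> V1"
    then have "c \<in> V2" using tree_edge[OF tree] by (auto simp: V1_def)
    then show "b = r" using cross[of c b] bc by (auto simp: V1_def insert_commute)
  qed (auto simp: V1_def)
  moreover have "E = insert {r, s} (E1 \<union> E2)"
  proof
    show "E \<subseteq> insert {r, s} (E1 \<union> E2)"
    proof
      fix e assume "e \<in> E"
      then obtain b c where bc: "b \<in> V" "c \<in> V" "e = {b, c}" using edges by blast
      then show "e \<in> insert {r, s} (E1 \<union> E2)"
        using cross[of b c] cross[of c b] \<open>e \<in> E\<close>
        by (auto simp: E1_def E2_def V1_def insert_commute)
    qed
  qed (use e in \<open>auto simp: E1_def E2_def\<close>)
  ultimately show ?thesis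
    using tree rV rV2 V2V by unfold_locales (auto simp: V1_def V2_def)
qed

section \<open>The generating function of cluster sizes\<close>

lemma eta_cong:
  assumes "\<And>e. e \<in> E \<Longrightarrow> a e = a' e"
  shows "eta V E a r v t = eta V E a' r v t"
proof (cases "is_tree V E")
  case True
  then show ?thesis
  proof (induction v rule: tree_induct[where r = r])
    case (1 v)
    then show ?case
      unfolding eta.simps[of V E a r v] eta.simps[of V E a' r v]
      using assms by (auto simp: ch_def intro!: prod.cong)
  qed
qed (simp add: eta.simps)

lemma eta_1:
  assumes tree: "is_tree V E"
  shows "eta V E a r v 1 = 1"
  using tree
proof (induction v rule: tree_induct[where r = r])
  case (1 v)
  then show ?case using eta.simps[of V E a r v 1] tree by simp
qed

text \<open>The expected sum of \<open>t\<close> to the cluster size over all clusters, when each edge \<open>e\<close> is kept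
with probability \<open>a e\<close>: every cluster is counted at its topmost vertex, which is the root or a
vertex \<open>j\<close> whose edge to the parent \<open>i\<close> has been removed.\<close>

definition cluster_gf :: "'v set \<Rightarrow> 'v set set \<Rightarrow> ('v set \<Rightarrow> real) \<Rightarrow> 'v \<Rightarrow> real \<Rightarrow> real" where
  "cluster_gf V E a r t = eta V E a r r t
     + (\<Sum>i\<in>V. \<Sum>j\<in>ch V E r i. (1 - a {i, j}) * eta V E a r j t)"

lemma cluster_gf_cong:
  assumes "\<And>e. e \<in> E \<Longrightarrow> a e = a' e"
  shows "cluster_gf V E a r t = cluster_gf V E a' r t"
proof -
  have "eta V E a r v t = eta V E a' r v t" for v by (rule eta_cong) fact
  then show ?thesis unfolding cluster_gf_def using assms by (auto simp: ch_def intro!: sum.cong)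
qed

context joined_trees
begin

text \<open>Keeping the joining edge, which happens with probability \<open>a {r, s}\<close>, replaces the clusters of
\<open>r\<close> and \<open>s\<close> by their union, whose size is the sum of two independent sizes.\<close>

lemma cluster_gf_joined:
  "cluster_gf V E a r t = cluster_gf V1 E1 a r t + cluster_gf V2 E2 a s t
     + a {r, s} * (eta V1 E1 a r r t * eta V2 E2 a s s t - eta V1 E1 a r r t - eta V2 E2 a s s t)"
proof -
  have fin: "finite V1" "finite V2" using tree_finite tree1 tree2 by auto
  let ?f = "\<lambda>i j. (1 - a {i, j}) * eta V E a r j t"
  have far: "(\<Sum>i\<in>V2. \<Sum>j\<in>ch V E r i. ?f i j)
      = (\<Sum>i\<in>V2. \<Sum>j\<in>ch V2 E2 s i. (1 - a {i, j}) * eta V2 E2 a s j t)"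
    using ch_subset[of V2 E2 s] by (intro sum.cong refl) (auto simp: ch_far eta_far subset_iff)
  have near: "(\<Sum>i\<in>V1 - {r}. \<Sum>j\<in>ch V E r i. ?f i j)
      = (\<Sum>i\<in>V1 - {r}. \<Sum>j\<in>ch V1 E1 r i. (1 - a {i, j}) * eta V1 E1 a r j t)"
  proof (rule sum.cong[OF refl])
    fix i assume i: "i \<in> V1 - {r}"
    then have "j \<in> V1 \<and> j \<noteq> r" if "j \<in> ch V1 E1 r i" for j
      using that ch_subset[of V1 E1 r i] root_notin_dsc[OF tree1, of i r] by (auto simp: ch_def)
    then show "(\<Sum>j\<in>ch V E r i. ?f i j) = (\<Sum>j\<in>ch V1 E1 r i. (1 - a {i, j}) * eta V1 E1 a r j t)"
      using i by (auto simp: ch_near eta_near intro!: sum.cong)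
  qed
  have root: "(\<Sum>j\<in>ch V E r r. ?f r j)
      = (1 - a {r, s}) * eta V2 E2 a s s t + (\<Sum>j\<in>ch V1 E1 r r. (1 - a {r, j}) * eta V1 E1 a r j t)"
    using finite_ch[OF tree1] s_notin_ch ch_root_near
    by (auto simp: ch_root eta_far s eta_near intro!: sum.cong)
  have "(\<Sum>i\<in>V. \<Sum>j\<in>ch V E r i. ?f i j) =
      (\<Sum>j\<in>ch V E r r. ?f r j) + (\<Sum>i\<in>V1 - {r}. \<Sum>j\<in>ch V E r i. ?f i j)
      + (\<Sum>i\<in>V2. \<Sum>j\<in>ch V E r i. ?f i j)"
    using fin disj r by (simp add: V sum.union_disjoint sum.remove[of V1 r])
  then show ?thesis
    unfolding far near root cluster_gf_def eta_root
    using fin r by (simp add: sum.remove[of V1 r] algebra_simps)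
qed

end

text \<open>Cutting the edge \<open>{r, s}\<close> leads to the same two parts whichever endpoint is the root, and the
formula for the joined tree is symmetric in them.\<close>

lemma cluster_gf_adjacent:
  assumes "is_tree V E" "{r, s} \<in> E"
  shows "cluster_gf V E a r t = cluster_gf V E a s t"
proof -
  obtain V1 V2 E1 E2 where j: "joined_trees V1 V2 V E1 E2 E r s"
    using cut_edge[OF assms] by blast
  show ?thesis
    using joined_trees.cluster_gf_joined[OF j, of a t]
      joined_trees.cluster_gf_joined[OF joined_trees.swap[OF j], of a t]
    by (simp add: insert_commute algebra_simps)
qed

lemma cluster_gf_root:
  assumes "is_tree V E" "r \<in> V" "s \<in> V"
  shows "cluster_gf V E a r t = cluster_gf V E a s t"
proof -
  obtain p where "is_path V E r p s" using tree_path_exists assms by metis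
  then have "successively (\<lambda>b c. {b, c} \<in> E) p" "p \<noteq> []" "hd p = r" "last p = s"
    by (auto simp: is_path_def)
  then show ?thesis
  proof (induction p arbitrary: r rule: induct_list012)
    case (3 x y zs)
    then show ?case using cluster_gf_adjacent[OF assms(1), of r y] by auto
  qed auto
qed

section \<open>Comparison of the cluster-size distributions\<close>

text \<open>A decreasing function vanishing from \<open>K\<close> on is a combination of indicators of initial segments,
with its decrements as coefficients.\<close>

lemma expectation_antimono_le:
  fixes g :: "nat \<Rightarrow> real"
  assumes st: "\<And>k. measure_pmf.prob p {k<..} \<le> measure_pmf.prob q {k<..}"
    and mono: "\<And>i. g (Suc i) \<le> g i" and zero: "\<And>n. K \<le> n \<Longrightarrow> g n = 0"
  shows "measure_pmf.expectation q g \<le> measure_pmf.expectation p g"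
proof -
  have g: "g n = (\<Sum>i<K. (g i - g (Suc i)) * indicator {..i} n)" for n
  proof (cases "n < K")
    case True
    then have "(\<Sum>i<K. (g i - g (Suc i)) * indicator {..i} n) = (\<Sum>i\<in>{n..<K}. (g i - g (Suc i)) * indicator {..i} n)"
      by (intro sum.mono_neutral_right) auto
    also have "\<dots> = (\<Sum>i\<in>{n..<K}. g i - g (Suc i))" by (intro sum.cong) auto
    also have "\<dots> = g n - g K" using True by (subst sum_Suc_diff'[of n K "\<lambda>i. - g i", simplified]) auto
    finally show ?thesis using zero[of K] by simp
  next
    case False
    then show ?thesis using zero by (auto intro!: sum.neutral[symmetric])
  qed
  have e: "measure_pmf.expectation r g = (\<Sum>i<K. (g i - g (Suc i)) * measure_pmf.prob r {..i})" for r
  proof -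
    have "measure_pmf.expectation r g
        = measure_pmf.expectation r (\<lambda>n. \<Sum>i<K. (g i - g (Suc i)) * indicator {..i} n)"
      by (rule Bochner_Integration.integral_cong[OF refl g])
    also have "\<dots> = (\<Sum>i<K. measure_pmf.expectation r (\<lambda>n. (g i - g (Suc i)) * indicator {..i} n))"
      by (rule Bochner_Integration.integral_sum)
        (intro integrable_mult_right measure_pmf.integrable_const_bound[where B = 1], auto)
    finally show ?thesis by simp
  qed
  have "measure_pmf.prob r {..k} = 1 - measure_pmf.prob r {k<..}" for r and k :: nat
    using measure_pmf.prob_compl[of "{k<..}" r] by (simp add: Compl_eq_Diff_UNIV[symmetric] not_less)
  then have "measure_pmf.prob q {..k} \<le> measure_pmf.prob p {..k}" for k using st by simp
  then show ?thesis unfolding e using mono by (intro sum_mono mult_left_mono) auto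
qed

text \<open>For fixed \<open>x\<close>, the function \<open>(k - n)\<^sup>+ - (k - (x + n))\<^sup>+\<close> is decreasing in \<open>n\<close>, because
\<open>(k - n)\<^sup>+\<close> is convex; it therefore has the larger expectation under the stochastically smaller
law \<open>p\<close>.\<close>

lemma expectation_conv_swap:
  fixes k :: nat
  assumes st: "\<And>k. measure_pmf.prob p {k<..} \<le> measure_pmf.prob q {k<..}"
  defines "f \<equiv> \<lambda>n::nat. real (k - n)"
  shows "measure_pmf.expectation (conv r p) f + measure_pmf.expectation q f
    \<le> measure_pmf.expectation (conv r q) f + measure_pmf.expectation p f"
proof -
  have bd: "\<bar>f n\<bar> \<le> real k" for n by (simp add: f_def)
  have int: "integrable (measure_pmf s) (\<lambda>n. f (x + n))" "integrable (measure_pmf s) f" for s x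
    by (rule integrable_pmf_bounded[where B = "real k"], rule bd)+
  let ?D = "\<lambda>s x. measure_pmf.expectation s (\<lambda>n. f (x + n)) - measure_pmf.expectation s f"
  have intE: "integrable (measure_pmf r) (\<lambda>x. measure_pmf.expectation s (\<lambda>n. f (x + n)))" for s
    by (rule integrable_pmf_bounded[where B = "real k"]) (rule expectation_bounded, rule bd)
  have "?D p x \<le> ?D q x" for x
  proof -
    have dec: "f (Suc i) - f (x + Suc i) \<le> f i - f (x + i)" for i
    proof -
      have "(k - Suc i) + (k - (x + i)) \<le> (k - i) + (k - (x + Suc i))" by arith
      then have "real ((k - Suc i) + (k - (x + i))) \<le> real ((k - i) + (k - (x + Suc i)))"
        by (simp only: of_nat_le_iff)
      then show ?thesis by (simp add: f_def)
    qed
    have "measure_pmf.expectation q (\<lambda>n. f n - f (x + n)) \<le> measure_pmf.expectation p (\<lambda>n. f n - f (x + n))"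
      by (rule expectation_antimono_le[where K = k and g = "\<lambda>n. f n - f (x + n)", OF st dec]) (simp add: f_def)
    then show ?thesis using int by simp
  qed
  then have "measure_pmf.expectation r (?D p) \<le> measure_pmf.expectation r (?D q)"
    by (intro integral_mono Bochner_Integration.integrable_diff intE) auto
  then show ?thesis
    using intE by (simp add: expectation_conv[where f = f, OF bd])
qed

text \<open>Read coefficientwise, the identity between generating functions says that \<open>j'\<close> exceeds \<open>j\<close> by
a nonnegative multiple of the signed measure whose integrals are compared in
\<open>expectation_conv_swap\<close>. Only finitely many coefficients enter the
expectation of \<open>(k - n)\<^sup>+\<close>.\<close>

lemma stop_loss_le_pgf_swap:
  assumes "0 < c" "0 \<le> d"
    and st: "\<And>k. measure_pmf.prob p {k<..} \<le> measure_pmf.prob q {k<..}"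
    and pgf_eq: "\<And>t. t \<in> {-1..1} \<Longrightarrow> c * (pgf j' t - pgf j t) = d * ((pgf r t - 1) * (pgf q t - pgf p t))"
  shows "stop_loss_le j j'"
  unfolding stop_loss_le_def
proof
  fix k :: nat
  define f where "f n = real (k - n)" for n :: nat
  let ?e = "\<lambda>s n. c * (pmf j' n - pmf j n)
      - d * (pmf (conv r q) n - pmf (conv r p) n - pmf q n + pmf p n)"
  have "?e s n = 0" for s n
  proof (rule powser_eq_0)
    fix t :: real assume t: "t \<in> {-1..1}"
    have "(\<lambda>n. c * (pmf j' n * t ^ n - pmf j n * t ^ n) - d * (pmf (conv r q) n * t ^ n
        - pmf (conv r p) n * t ^ n - pmf q n * t ^ n + pmf p n * t ^ n)) sums
      (c * (pgf j' t - pgf j t) - d * (pgf (conv r q) t - pgf (conv r p) t - pgf q t + pgf p t))"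
      using t by (intro sums_diff sums_add sums_mult pgf_sums)
    also have "(c * (pgf j' t - pgf j t) - d * (pgf (conv r q) t - pgf (conv r p) t - pgf q t + pgf p t)) = 0"
      using pgf_eq[OF t] t by (simp add: pgf_conv algebra_simps)
    finally show "(\<lambda>n. ?e s n * t ^ n) sums 0" by (simp add: algebra_simps)
  qed
  then have "(\<Sum>n<k. f n * ?e j n) = 0" by simp
  moreover have "measure_pmf.expectation s f = (\<Sum>n<k. f n * pmf s n)" for s
    by (rule integral_measure_pmf_real) (auto simp: f_def)
  ultimately have eq: "c * (measure_pmf.expectation j' f - measure_pmf.expectation j f)
    = d * (measure_pmf.expectation (conv r q) f - measure_pmf.expectation (conv r p) f
        - measure_pmf.expectation q f + measure_pmf.expectation p f)"
    by (simp add: algebra_simps sum.distrib sum_subtractf sum_distrib_left)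
  have "0 \<le> measure_pmf.expectation (conv r q) f - measure_pmf.expectation (conv r p) f
        - measure_pmf.expectation q f + measure_pmf.expectation p f"
    using expectation_conv_swap[OF st, of r k] by (simp add: f_def[abs_def])
  with \<open>0 \<le> d\<close> have "0 \<le> c * (measure_pmf.expectation j' f - measure_pmf.expectation j f)"
    unfolding eq by (rule mult_nonneg_nonneg)
  then show "measure_pmf.expectation j (\<lambda>n. real (k - n)) \<le> measure_pmf.expectation j' (\<lambda>n. real (k - n))"
    unfolding f_def[abs_def] using \<open>0 < c\<close> by (simp add: zero_le_mult_iff)
qed

lemma eta_pgf_cone:
  assumes tree: "is_tree V E" and a: "\<And>e. e \<in> E \<Longrightarrow> a e \<in> {0..1}"
  shows "eta V E a r v \<in> pgf_cone"
  using tree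
proof (induction v rule: tree_induct[where r = r])
  case (1 v)
  have "(\<lambda>t. t * (\<Prod>j\<in>ch V E r v. (1 - a {v, j}) + a {v, j} * eta V E a r j t)) \<in> pgf_cone"
  proof (intro pgf_cone_mult[OF pgf_cone_id] pgf_cone_prod pgf_cone_add pgf_cone_mult pgf_cone_const 1)
    fix j assume "j \<in> ch V E r v"
    then have "a {v, j} \<in> {0..1}" using a by (simp add: ch_def)
    then show "0 \<le> 1 - a {v, j}" "0 \<le> a {v, j}" by auto
  qed
  then show ?case using tree by (subst eta.simps[abs_def]) simp
qed

lemma eta_pgf:
  assumes "is_tree V E" "\<And>e. e \<in> E \<Longrightarrow> a e \<in> {0..1}"
  shows "\<exists>p. \<forall>t\<in>{-1..1}. eta V E a r v t = pgf p t"
  using pgf_coneD[of "eta V E a r v"] eta_pgf_cone[of V E a r v] eta_1[OF assms(1)] assms(2)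
  by (simp add: assms(1))

lemma cluster_gf_pos:
  assumes tree: "is_tree V E" and a: "\<And>e. e \<in> E \<Longrightarrow> a e \<in> {0..1}"
  shows "0 < cluster_gf V E a r 1"
proof -
  have "0 \<le> 1 - a {i, j}" if "j \<in> ch V E r i" for i j
    using a that by (simp add: ch_def)
  then show ?thesis
    unfolding cluster_gf_def by (simp add: eta_1[OF tree] add_pos_nonneg sum_nonneg)
qed

lemma cluster_gf_pgf:
  assumes tree: "is_tree V E" and a: "\<And>e. e \<in> E \<Longrightarrow> a e \<in> {0..1}"
  shows "\<exists>p. \<forall>t\<in>{-1..1}. cluster_gf V E a r t = cluster_gf V E a r 1 * pgf p t"
proof -
  have "0 \<le> 1 - a {i, j}" if "j \<in> ch V E r i" for i j
    using a that by (simp add: ch_def)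
  then have "cluster_gf V E a r \<in> pgf_cone"
    unfolding cluster_gf_def[abs_def]
    by (intro pgf_cone_add pgf_cone_sum pgf_cone_mult pgf_cone_const eta_pgf_cone tree a)
  then show ?thesis by (rule pgf_coneD)
qed

section \<open>The law of a vector built down a tree\<close>

fun parents_later :: "('v \<Rightarrow> 'v) \<Rightarrow> 'v \<Rightarrow> 'v list \<Rightarrow> bool" where
  "parents_later pr r [] \<longleftrightarrow> True"
| "parents_later pr r (j # js) \<longleftrightarrow> j \<notin> set js \<and> (j \<noteq> r \<longrightarrow> pr j \<in> set js) \<and> parents_later pr r js"

text \<open>Repeatedly take away a vertex with the least value of \<open>f\<close>: it is the parent of none of the
remaining ones.\<close>

lemma ex_parents_later:
  fixes f :: "'v \<Rightarrow> nat"
  assumes "finite S" "\<And>v. v \<in> S \<Longrightarrow> v \<noteq> r \<Longrightarrow> pr v \<in> S \<and> f v < f (pr v)"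
  shows "\<exists>js. set js = S \<and> parents_later pr r js"
  using assms
proof (induction "card S" arbitrary: S)
  case 0
  then show ?case by (intro exI[of _ "[]"]) auto
next
  case (Suc m)
  then have "S \<noteq> {}" by auto
  with Suc.prems obtain j where j: "j \<in> S" "\<And>v. v \<in> S \<Longrightarrow> f j \<le> f v"
    using ex_min_if_finite[of "f ` S"] by (auto simp: not_less)
  have "\<exists>js. set js = S - {j} \<and> parents_later pr r js"
  proof (rule Suc.hyps(1))
    fix v assume v: "v \<in> S - {j}" "v \<noteq> r"
    then have "pr v \<in> S" "f v < f (pr v)" "f j \<le> f v" using Suc.prems j by auto
    then show "pr v \<in> S - {j} \<and> f v < f (pr v)" by auto
  qed (use Suc j in auto)
  then obtain js where js: "set js = S - {j}" "parents_later pr r js" by blast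
  have "pr j \<in> S - {j}" if "j \<noteq> r" using Suc.prems(2)[OF j(1) that] by auto
  with js j show ?case by (intro exI[of _ "j # js"]) auto
qed

text \<open>The law of a vector whose coordinates are drawn from the last entry of the list to the first,
each one depending on the value at its parent only. Coordinates outside the list keep the value
\<open>undefined\<close>, so the vectors are extensional functions and are determined by the
coordinates in the list.\<close>

primrec tree_law :: "('v \<Rightarrow> 'v) \<Rightarrow> ('v \<Rightarrow> nat \<Rightarrow> nat pmf) \<Rightarrow> 'v list \<Rightarrow> ('v \<Rightarrow> nat) pmf" where
  "tree_law pr \<kappa> [] = return_pmf (\<lambda>_. undefined)"
| "tree_law pr \<kappa> (j # js) =
     bind_pmf (tree_law pr \<kappa> js) (\<lambda>n. map_pmf (\<lambda>m. n(j := m)) (\<kappa> j (n (pr j))))"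

lemma set_tree_law: "n \<in> set_pmf (tree_law pr \<kappa> js) \<Longrightarrow> n \<in> extensional (set js)"
  by (induction js arbitrary: n) (auto simp: extensional_def)

text \<open>At the root \<open>r\<close>, the value \<open>pr r\<close> carries no meaning; this is why \<open>\<kappa> r\<close> must not
depend on its argument.\<close>

lemma pmf_tree_law:
  assumes "parents_later pr r js" and const: "\<And>m k. \<kappa> r m = \<kappa> r k"
    and "n \<in> extensional (set js)"
  shows "pmf (tree_law pr \<kappa> js) n = (\<Prod>v\<in>set js. pmf (\<kappa> v (n (pr v))) (n v))"
  using assms(1,3)
proof (induction js arbitrary: n)
  case Nil
  then have "n = (\<lambda>_. undefined)" by (auto simp: extensional_def)
  then show ?case by simp
next
  case (Cons j js)
  define n' where "n' = n(j := undefined)"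
  have j: "j \<notin> set js" and js: "parents_later pr r js" and pr: "j \<noteq> r \<Longrightarrow> pr j \<in> set js"
    using Cons.prems by auto
  have n': "n' \<in> extensional (set js)" using Cons.prems by (auto simp: n'_def extensional_def)
  have n: "n'(j := n j) = n" by (simp add: n'_def)
  have zero: "x = n'" if x: "x \<in> set_pmf (tree_law pr \<kappa> js)"
    and nz: "pmf (map_pmf (\<lambda>m. x(j := m)) (\<kappa> j (x (pr j)))) n \<noteq> 0" for x
  proof -
    obtain m where "n = x(j := m)" using nz by (auto simp: pmf_eq_0_set_pmf)
    moreover have "x j = undefined" using set_tree_law[OF x] j by (auto simp: extensional_def)
    ultimately show "x = n'" by (auto simp: n'_def)
  qed
  have "pmf (tree_law pr \<kappa> (j # js)) n
      = measure_pmf.expectation (tree_law pr \<kappa> js) (\<lambda>x. pmf (map_pmf (\<lambda>m. x(j := m)) (\<kappa> j (x (pr j)))) n)"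
    by (simp add: pmf_bind)
  also have "\<dots> = (\<Sum>x\<in>{n'}. pmf (map_pmf (\<lambda>m. x(j := m)) (\<kappa> j (x (pr j)))) n * pmf (tree_law pr \<kappa> js) x)"
    by (rule integral_measure_pmf_real) (use zero in auto)
  also have "\<dots> = pmf (map_pmf (\<lambda>m. n'(j := m)) (\<kappa> j (n' (pr j)))) (n'(j := n j)) * pmf (tree_law pr \<kappa> js) n'"
    by (simp add: n)
  also have "pmf (map_pmf (\<lambda>m. n'(j := m)) (\<kappa> j (n' (pr j)))) (n'(j := n j)) = pmf (\<kappa> j (n' (pr j))) (n j)"
  proof (rule pmf_map_inj')
    show "inj (\<lambda>m. n'(j := m))" by (rule injI) (metis fun_upd_same)
  qed
  also have "\<kappa> j (n' (pr j)) = \<kappa> j (n (pr j))"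
    using pr j const by (cases "j = r") (auto simp: n'_def)
  also have "pmf (tree_law pr \<kappa> js) n' = (\<Prod>v\<in>set js. pmf (\<kappa> v (n' (pr v))) (n' v))"
    by (rule Cons.IH[OF js n'])
  also have "\<dots> = (\<Prod>v\<in>set js. pmf (\<kappa> v (n (pr v))) (n v))"
  proof (rule prod.cong[OF refl])
    fix v assume v: "v \<in> set js"
    have "v \<noteq> r \<Longrightarrow> pr v \<in> set js" using js v by (induction js) auto
    then have "\<kappa> v (n' (pr v)) = \<kappa> v (n (pr v))"
      using j const by (cases "v = r") (auto simp: n'_def)
    then show "pmf (\<kappa> v (n' (pr v))) (n' v) = pmf (\<kappa> v (n (pr v))) (n v)"
      using v j by (auto simp: n'_def)
  qed
  finally show ?case using j by simp
qed

lemma parents_later_parent: "parents_later pr r js \<Longrightarrow> v \<in> set js \<Longrightarrow> v \<noteq> r \<Longrightarrow> pr v \<in> set js"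
  by (induction js) auto

text \<open>The coordinates are integrated out from the front of the list, children before parents. Summing
over the coordinate at \<open>j\<close> leaves a constant and multiplies the base of the power at the parent of
\<open>j\<close> by \<open>1 - \<beta> j + \<beta> j * \<eta> j\<close>. Hence the base at \<open>v\<close> contains the factors of
those children that are no longer in the list, and it has become \<open>\<eta> v\<close> by the time when \<open>v\<close>
itself is at the front.\<close>

lemma expectation_tree_law:
  fixes \<eta> \<beta> rate :: "'v \<Rightarrow> real" and ch :: "'v \<Rightarrow> 'v set"
  assumes t: "t \<in> {-1..1}" and \<eta>_bd: "\<And>v. v \<in> S \<Longrightarrow> \<eta> v \<in> {-1..1}"
    and \<beta>: "\<And>v. v \<in> S \<Longrightarrow> \<beta> v \<in> {0..1}" and \<beta>r: "\<beta> r = 0"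
    and S: "finite S" and ch: "\<And>v j. j \<in> ch v \<longleftrightarrow> j \<in> S - {r} \<and> pr j = v"
    and \<eta>: "\<And>v. v \<in> S \<Longrightarrow> \<eta> v = t * (\<Prod>j\<in>ch v. 1 - \<beta> j + \<beta> j * \<eta> j)"
    and \<kappa>: "\<And>v k y. v \<in> S \<Longrightarrow> y \<in> {-1..1} \<Longrightarrow>
      pgf (\<kappa> v k) y = exp (rate v * (y - 1)) * (1 - \<beta> v + \<beta> v * y) ^ k"
    and js: "parents_later pr r js" "set js \<subseteq> S"
  shows "measure_pmf.expectation (tree_law pr \<kappa> js)
      (\<lambda>n. \<Prod>v\<in>set js. (t * (\<Prod>j\<in>ch v - set js. 1 - \<beta> j + \<beta> j * \<eta> j)) ^ n v)
    = (\<Prod>v\<in>set js. exp (rate v * (\<eta> v - 1)))"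
  using js
proof (induction js)
  case Nil
  show ?case by simp
next
  case (Cons j js)
  have j: "j \<notin> set js" "j \<in> S" and js: "parents_later pr r js" "set js \<subseteq> S" and pr: "j \<noteq> r \<Longrightarrow> pr j \<in> set js"
    using Cons.prems by auto
  define \<theta> where "\<theta> i = 1 - \<beta> i + \<beta> i * \<eta> i" for i
  define b where "b R v = t * (\<Prod>i\<in>ch v - R. \<theta> i)" for R v
  have fin: "finite (ch v)" for v by (rule finite_subset[OF _ S]) (auto simp: ch)
  have \<theta>_bd: "\<bar>\<theta> i\<bar> \<le> 1" if "i \<in> S" for i
  proof -
    have "\<bar>\<beta> i * \<eta> i\<bar> \<le> \<beta> i"
      using mult_left_mono[of "\<bar>\<eta> i\<bar>" 1 "\<beta> i"] \<eta>_bd[OF that] \<beta>[OF that] by (auto simp: abs_mult)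
    then show ?thesis using \<beta>[OF that] unfolding \<theta>_def by auto
  qed
  have b_bd: "\<bar>b R v\<bar> \<le> 1" for R v
  proof -
    have "\<bar>\<Prod>i\<in>ch v - R. \<theta> i\<bar> \<le> 1"
      unfolding abs_prod by (rule prod_le_1) (use \<theta>_bd ch in auto)
    then show ?thesis using t unfolding b_def abs_mult by (intro mult_le_one) auto
  qed
  have prod_bd: "\<bar>\<Prod>v\<in>A. b R v ^ n v\<bar> \<le> 1" for A R and n :: "'v \<Rightarrow> nat"
    unfolding abs_prod by (rule prod_le_1) (use b_bd in \<open>auto simp: power_abs intro!: power_le_one\<close>)
  have "ch j \<inter> set (j # js) = {}"
  proof (rule ccontr)
    assume "ch j \<inter> set (j # js) \<noteq> {}"
    then obtain c where "c \<in> ch j" and c: "c \<in> set (j # js)" by blast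
    then have "c \<noteq> r" "pr c = j" by (auto simp: ch)
    with c show False using parents_later_parent[OF js(1)] pr j by (cases "c = j") auto
  qed
  then have bj: "b (set (j # js)) j = \<eta> j"
    using \<eta>[OF j(2)] by (simp add: b_def \<theta>_def Diff_triv)
  \<comment> \<open>Removing \<open>j\<close> from the list changes the base at the parent of \<open>j\<close> only.\<close>
  have split: "(\<Prod>v\<in>set js. b (set js) v ^ n v) = (\<Prod>v\<in>set js. b (set (j # js)) v ^ n v) * \<theta> j ^ n (pr j)"
    for n :: "'v \<Rightarrow> nat"
  proof (cases "j = r")
    case True
    then have "ch v - set (j # js) = ch v - set js" for v by (auto simp: ch)
    then have "b (set (j # js)) = b (set js)" by (simp add: b_def fun_eq_iff)
    then show ?thesis using True by (simp add: \<theta>_def \<beta>r)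
  next
    case False
    have "b (set js) v = b (set (j # js)) v" if "v \<noteq> pr j" for v
    proof -
      have "ch v - set (j # js) = ch v - set js" using that by (auto simp: ch)
      then show ?thesis by (simp add: b_def)
    qed
    moreover have "b (set js) (pr j) = b (set (j # js)) (pr j) * \<theta> j"
    proof -
      have "j \<in> ch (pr j) - set js" using False j by (simp add: ch)
      moreover have "ch (pr j) - set js - {j} = ch (pr j) - set (j # js)" by auto
      ultimately have "(\<Prod>i\<in>ch (pr j) - set js. \<theta> i) = \<theta> j * (\<Prod>i\<in>ch (pr j) - set (j # js). \<theta> i)"
        using prod.remove[of "ch (pr j) - set js" j \<theta>] fin by simp
      then show ?thesis unfolding b_def by (simp only: mult_ac)
    qed
    ultimately have *: "b (set js) v ^ n v
        = b (set (j # js)) v ^ n v * (if v = pr j then \<theta> j ^ n (pr j) else 1)" for v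
      by (cases "v = pr j") (simp_all add: power_mult_distrib)
    show ?thesis
      unfolding * prod.distrib using pr[OF False] by (simp only: prod.delta finite_set if_True)
  qed
  have inner: "measure_pmf.expectation (\<kappa> j (n (pr j))) (\<lambda>m. \<Prod>v\<in>set (j # js). b (set (j # js)) v ^ (n(j := m)) v)
      = exp (rate j * (\<eta> j - 1)) * (\<Prod>v\<in>set js. b (set js) v ^ n v)" for n
  proof -
    have "(\<Prod>v\<in>set (j # js). b (set (j # js)) v ^ (n(j := m)) v)
        = (\<Prod>v\<in>set js. b (set (j # js)) v ^ n v) * \<eta> j ^ m" for m
    proof -
      have "(\<Prod>v\<in>set js. b (set (j # js)) v ^ (n(j := m)) v) = (\<Prod>v\<in>set js. b (set (j # js)) v ^ n v)"
        by (rule prod.cong) (use j in auto)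
      then show ?thesis using j bj by simp
    qed
    then have "measure_pmf.expectation (\<kappa> j (n (pr j))) (\<lambda>m. \<Prod>v\<in>set (j # js). b (set (j # js)) v ^ (n(j := m)) v)
        = (\<Prod>v\<in>set js. b (set (j # js)) v ^ n v) * pgf (\<kappa> j (n (pr j))) (\<eta> j)"
      by (simp add: pgf_def)
    also have "\<dots> = exp (rate j * (\<eta> j - 1)) * (\<Prod>v\<in>set js. b (set js) v ^ n v)"
      using \<kappa>[OF j(2) \<eta>_bd[OF j(2)], of "n (pr j)"]
      unfolding split \<theta>_def by (simp only: mult_ac)
    finally show ?thesis .
  qed
  have "measure_pmf.expectation (tree_law pr \<kappa> (j # js)) (\<lambda>n. \<Prod>v\<in>set (j # js). b (set (j # js)) v ^ n v)
      = measure_pmf.expectation (tree_law pr \<kappa> js) (\<lambda>n. exp (rate j * (\<eta> j - 1)) * (\<Prod>v\<in>set js. b (set js) v ^ n v))"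
    unfolding tree_law.simps
      expectation_bind_pmf[where f = "\<lambda>n. \<Prod>v\<in>set (j # js). b (set (j # js)) v ^ n v" and B = 1, OF prod_bd]
      integral_map_pmf inner ..
  also have "\<dots> = exp (rate j * (\<eta> j - 1)) * (\<Prod>v\<in>set js. exp (rate v * (\<eta> v - 1)))"
    using Cons.IH[OF js] by (simp add: b_def \<theta>_def)
  finally show ?case using j by (simp add: b_def \<theta>_def)
qed

text \<open>Every coordinate has mean \<open>l\<close>. This makes the means of the totals over two trees on the same
vertices equal, which the lower stop-loss order alone does not imply.\<close>

lemma mean_tree_law:
  assumes "parents_later pr r js" "v \<in> set js"
    and \<kappa>: "\<And>v k. v \<in> set js \<Longrightarrow> (\<integral>\<^sup>+m. real m \<partial>measure_pmf (\<kappa> v k)) = ennreal (l * (1 - \<beta> v) + \<beta> v * real k)"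
    and \<beta>: "\<And>v. v \<in> set js \<Longrightarrow> \<beta> v \<in> {0..1}" and \<beta>r: "\<beta> r = 0" and l: "0 \<le> l"
  shows "(\<integral>\<^sup>+n. real (n v) \<partial>tree_law pr \<kappa> js) = ennreal l"
  using assms(1-4)
proof (induction js arbitrary: v)
  case (Cons j js)
  show ?case
  proof (cases "v = j")
    case False
    then show ?thesis using Cons by simp
  next
    case True
    have \<beta>j: "0 \<le> \<beta> j" "0 \<le> 1 - \<beta> j" using Cons.prems(4)[of j] by auto
    have "(\<integral>\<^sup>+n. real (n v) \<partial>tree_law pr \<kappa> (j # js))
        = (\<integral>\<^sup>+n. ennreal (l * (1 - \<beta> j)) + ennreal (\<beta> j) * real (n (pr j)) \<partial>tree_law pr \<kappa> js)"
      using True Cons.prems \<beta>j l by (simp add: ennreal_plus ennreal_mult)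
    also have "\<dots> = ennreal (l * (1 - \<beta> j)) + ennreal (\<beta> j) * (\<integral>\<^sup>+n. real (n (pr j)) \<partial>tree_law pr \<kappa> js)"
      by (simp add: nn_integral_add nn_integral_cmult)
    also have "\<dots> = ennreal l"
    proof (cases "j = r")
      case False
      then have "(\<integral>\<^sup>+n. real (n (pr j)) \<partial>tree_law pr \<kappa> js) = ennreal l" using Cons by simp
      moreover have "ennreal (l * (1 - \<beta> j) + \<beta> j * l) = ennreal (l * (1 - \<beta> j)) + ennreal (\<beta> j) * ennreal l"
        using \<beta>j l by (subst ennreal_plus) (auto simp: ennreal_mult)
      moreover have "l * (1 - \<beta> j) + \<beta> j * l = l" by (simp add: algebra_simps)
      ultimately show ?thesis by simp
    qed (simp add: \<beta>r)
    finally show ?thesis .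
  qed
qed simp

section \<open>Thinning and adding Poisson immigrants\<close>

text \<open>The law of a count whose parent has the value \<open>k\<close>: \<open>k\<close> individuals thinned with parameter
\<open>\<beta>\<close>, plus independent Poisson immigrants. For \<open>\<beta> = 0\<close> this is the law of the root,
whatever \<open>k\<close> is.\<close>

definition thinning_step :: "real \<Rightarrow> real \<Rightarrow> nat \<Rightarrow> nat pmf" where
  "thinning_step l \<beta> k = conv (poisson0_pmf (l * (1 - \<beta>))) (conv_pow (map_pmf of_bool (bernoulli_pmf \<beta>)) k)"

lemma pgf_thinning_step:
  assumes "0 \<le> l" "\<beta> \<in> {0..1}" "t \<in> {-1..1}"
  shows "pgf (thinning_step l \<beta> k) t = exp (l * (1 - \<beta>) * (t - 1)) * (1 - \<beta> + \<beta> * t) ^ k"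
  using assms by (simp add: thinning_step_def pgf_conv pgf_conv_pow pgf_poisson pgf_bernoulli)

lemma thinning_step_0: "0 \<le> l \<Longrightarrow> thinning_step l 0 m = thinning_step l 0 k"
  by (rule pmf_eq_pgfI) (simp add: pgf_thinning_step)

lemma mean_conv: "(\<integral>\<^sup>+n. real n \<partial>conv p q) = (\<integral>\<^sup>+n. real n \<partial>p) + (\<integral>\<^sup>+n. real n \<partial>q)"
  by (simp add: conv_def ennreal_plus nn_integral_add)

lemma mean_poisson:
  assumes "0 \<le> l"
  shows "(\<integral>\<^sup>+n. real n \<partial>poisson0_pmf l) = ennreal l"
proof (cases "l = 0")
  case False
  with assms have l: "0 < l" by simp
  have "(\<lambda>n. exp (- l) * l * (l ^ n /\<^sub>R fact n)) sums (exp (- l) * l * exp l)"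
    by (intro sums_mult exp_converges)
  also have "(\<lambda>n. exp (- l) * l * (l ^ n /\<^sub>R fact n)) = (\<lambda>n. pmf (poisson0_pmf l) (Suc n) * real (Suc n))"
    using l by (auto simp: poisson0_pmf_def field_simps simp del: of_nat_Suc)
  also have "exp (- l) * l * exp l = l" by (simp add: exp_minus)
  finally have "(\<lambda>n. pmf (poisson0_pmf l) n * real n) sums l"
    by (subst (asm) sums_Suc_iff) simp
  then have "(\<Sum>n. ennreal (pmf (poisson0_pmf l) n * real n)) = ennreal l"
    by (intro suminf_ennreal_eq) auto
  then show ?thesis
    by (simp add: nn_integral_measure_pmf nn_integral_count_space_nat ennreal_mult')
qed (simp add: poisson0_pmf_def)

lemma mean_thinning_step:
  assumes "0 \<le> l" "\<beta> \<in> {0..1}"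
  shows "(\<integral>\<^sup>+n. real n \<partial>thinning_step l \<beta> k) = ennreal (l * (1 - \<beta>) + \<beta> * real k)"
proof -
  have "(\<integral>\<^sup>+n. real n \<partial>conv_pow (map_pmf of_bool (bernoulli_pmf \<beta>)) k) = ennreal (\<beta> * real k)"
    using assms by (induction k)
      (simp_all add: mean_conv ennreal_plus[symmetric] algebra_simps del: ennreal_plus)
  then show ?thesis using assms
    by (simp add: thinning_step_def mean_conv mean_poisson ennreal_plus[symmetric] del: ennreal_plus)
qed

section \<open>From random variables to their laws\<close>

lemma distr_nat_pmf:
  fixes X :: "'a \<Rightarrow> nat"
  assumes "prob_space P" "X \<in> P \<rightarrow>\<^sub>M count_space UNIV"
  obtains p where "distr P (count_space UNIV) X = measure_pmf p"
proof -
  interpret P: prob_space P by fact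
  interpret D: prob_space "distr P (count_space UNIV) X" using assms by (intro P.prob_space_distr)
  have "AE x in distr P (count_space UNIV) X. measure (distr P (count_space UNIV) X) {x} \<noteq> 0"
    by (subst D.AE_support_countable) (auto intro!: exI[of _ UNIV])
  then have "measure_pmf (Abs_pmf (distr P (count_space UNIV) X)) = distr P (count_space UNIV) X"
    by (intro Abs_pmf_inverse) (auto intro: D.prob_space_axioms)
  then show ?thesis by (intro that) (rule sym)
qed

lemma pgf_distr:
  assumes "distr P (count_space UNIV) X = measure_pmf p" "X \<in> P \<rightarrow>\<^sub>M count_space UNIV"
  shows "pgf p t = (\<integral>\<omega>. t ^ X \<omega> \<partial>P)"
  unfolding pgf_def assms(1)[symmetric] using assms(2) by (intro integral_distr) auto

lemma measurable_sum_nat: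
  fixes X :: "'i \<Rightarrow> 'a \<Rightarrow> nat"
  assumes "\<And>i. i \<in> A \<Longrightarrow> X i \<in> M \<rightarrow>\<^sub>M count_space UNIV"
  shows "(\<lambda>\<omega>. \<Sum>i\<in>A. X i \<omega>) \<in> M \<rightarrow>\<^sub>M count_space UNIV"
proof -
  have "measurable M (count_space UNIV) = measurable M (borel :: nat measure)"
    by (rule measurable_cong_sets) (auto simp: sets_borel_eq_count_space)
  then show ?thesis using assms by (auto intro: borel_measurable_sum)
qed

lemma measurable_add_nat:
  fixes X Y :: "'a \<Rightarrow> nat"
  assumes "X \<in> M \<rightarrow>\<^sub>M count_space UNIV" "Y \<in> M \<rightarrow>\<^sub>M count_space UNIV"
  shows "(\<lambda>\<omega>. X \<omega> + Y \<omega>) \<in> M \<rightarrow>\<^sub>M count_space UNIV"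
  using measurable_sum_nat[of "{True, False}" "\<lambda>b. if b then X else Y" M] assms by simp

lemma measurable_thin:
  assumes "\<And>i. I i \<in> M \<rightarrow>\<^sub>M count_space UNIV" "N \<in> M \<rightarrow>\<^sub>M count_space UNIV"
  shows "thin I N \<in> M \<rightarrow>\<^sub>M count_space UNIV"
  unfolding thin_def[abs_def]
  by (rule measurable_compose_countable[where f = "\<lambda>k \<omega>. \<Sum>i=1..k. I i \<omega>"])
    (use assms in \<open>auto intro: measurable_sum_nat\<close>)

text \<open>Both laws have the same generating function, because expectations of products of independent
variables factorise.\<close>

lemma (in prob_space) indep_sum_law:
  fixes X :: "'i \<Rightarrow> 'a \<Rightarrow> nat"
  assumes ind: "indep_vars (\<lambda>_. count_space UNIV) X A" and A: "finite A"
    and law: "\<And>i. i \<in> A \<Longrightarrow> distr M (count_space UNIV) (X i) = measure_pmf (p i)"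
    and q: "\<And>t. t \<in> {-1..1} \<Longrightarrow> pgf q t = (\<Prod>i\<in>A. pgf (p i) t)"
  shows "distr M (count_space UNIV) (\<lambda>\<omega>. \<Sum>i\<in>A. X i \<omega>) = measure_pmf q"
proof -
  have X: "X i \<in> M \<rightarrow>\<^sub>M count_space UNIV" if "i \<in> A" for i
    using ind that by (simp add: indep_vars_def)
  have S: "(\<lambda>\<omega>. \<Sum>i\<in>A. X i \<omega>) \<in> M \<rightarrow>\<^sub>M count_space UNIV" by (rule measurable_sum_nat) fact
  obtain s where s: "distr M (count_space UNIV) (\<lambda>\<omega>. \<Sum>i\<in>A. X i \<omega>) = measure_pmf s"
    using distr_nat_pmf[OF prob_space_axioms S] .
  have "pgf s t = pgf q t" if t: "t \<in> {-1..1}" for t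
  proof -
    have ind_pow: "indep_vars (\<lambda>_. borel) (\<lambda>i \<omega>. t ^ X i \<omega>) A"
      by (rule indep_vars_compose2[OF ind]) simp
    have "integrable M (\<lambda>\<omega>. t ^ X i \<omega>)" if "i \<in> A" for i
      using X[OF that] abs_power_le_1[OF t]
      by (intro integrable_const_bound[where B = 1]) (auto intro: measurable_compose)
    then have "(\<integral>\<omega>. (\<Prod>i\<in>A. t ^ X i \<omega>) \<partial>M) = (\<Prod>i\<in>A. \<integral>\<omega>. t ^ X i \<omega> \<partial>M)"
      using indep_vars_lebesgue_integral[OF A ind_pow] by blast
    also have "\<dots> = (\<Prod>i\<in>A. pgf (p i) t)"
      using pgf_distr[OF law X] by (intro prod.cong) auto
    finally show ?thesis using pgf_distr[OF s S] q[OF t] by (simp add: power_sum)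
  qed
  then have "s = q" by (rule pmf_eq_pgfI)
  then show ?thesis using s by simp
qed

section \<open>The law of the constructed vector\<close>

text \<open>The parameter of the edge from a vertex to its parent. The value 0 at the root lets the root be
treated like the other vertices, as one that inherits nothing.\<close>

definition edge_weight :: "'v set \<Rightarrow> 'v set set \<Rightarrow> ('v set \<Rightarrow> real) \<Rightarrow> 'v \<Rightarrow> 'v \<Rightarrow> real" where
  "edge_weight V E a r v = (if v = r then 0 else a {pa V E r v, v})"

lemma parent_edge: "is_tree V E \<Longrightarrow> r \<in> V \<Longrightarrow> v \<in> V \<Longrightarrow> v \<noteq> r \<Longrightarrow> {pa V E r v, v} \<in> E"
  using parent_child(1)[of V E r v] by (auto simp: ch_def)

lemma edge_weight_bounds:
  assumes "is_tree V E" "r \<in> V" "\<And>e. e \<in> E \<Longrightarrow> a e \<in> {0..1}" "v \<in> V"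
  shows "edge_weight V E a r v \<in> {0..1}"
  using assms(3)[OF parent_edge[OF assms(1,2,4)]] by (simp add: edge_weight_def)

lemma vertex_order:
  assumes tree: "is_tree V E" and r: "r \<in> V"
  obtains js where "set js = V" "parents_later (pa V E r) r js"
proof -
  have "pa V E r v \<in> V \<and> card (dsc V E r v) < card (dsc V E r (pa V E r v))" if "v \<in> V" "v \<noteq> r" for v
  proof
    have "v \<in> ch V E r (pa V E r v)" using parent_child(1)[OF tree r that] by simp
    from dsc_child_psubset[OF tree this]
    show "card (dsc V E r v) < card (dsc V E r (pa V E r v))"
      using finite_subset[OF dsc_subset tree_finite[OF tree]] by (intro psubset_card_mono)
  qed (use parent_child(2)[OF tree r that] in simp)
  then obtain js where "set js = V \<and> parents_later (pa V E r) r js"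
    using ex_parents_later[OF tree_finite[OF tree], of r "pa V E r" "\<lambda>v. card (dsc V E r v)"] by blast
  then show ?thesis using that by blast
qed

context
  fixes Q :: "'w measure" and V :: "'v set" and E l a r L I K
  assumes tree: "is_tree V E" and r: "r \<in> V" and l: "0 \<le> l"
    and a: "\<And>e. e \<in> E \<Longrightarrow> a e \<in> {0..1}"
    and C: "mpmrf_construction Q V E l a r L I K"
begin

interpretation prob_space Q using C by (simp add: mpmrf_construction_def)

text \<open>The Poisson and the thinning variables as the single independent family of the construction.\<close>

definition source :: "'v + 'v \<times> nat \<Rightarrow> 'w \<Rightarrow> nat" where
  "source = case_sum L (\<lambda>(v, i). I v i)"

lemma source_simps [simp]: "source (Inl v) = L v" "source (Inr (v, i)) = I v i"
  by (auto simp: source_def)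

lemma indep_source: "indep_vars (\<lambda>_. count_space UNIV) source (V <+> (V - {r}) \<times> UNIV)"
  using C by (simp add: mpmrf_construction_def source_def)

lemma source_measurable: "x \<in> V <+> (V - {r}) \<times> UNIV \<Longrightarrow> source x \<in> Q \<rightarrow>\<^sub>M count_space UNIV"
  using indep_source by (simp add: indep_vars_def)

lemma K_root: "\<omega> \<in> space Q \<Longrightarrow> K r \<omega> = L r \<omega>"
  and K_step: "\<omega> \<in> space Q \<Longrightarrow> v \<in> V \<Longrightarrow> v \<noteq> r \<Longrightarrow> K v \<omega> = L v \<omega> + thin (I v) (K (pa V E r v)) \<omega>"
  using C by (auto simp: mpmrf_construction_def)

lemma construction_measurable:
  assumes "v \<in> V"
  shows "K v \<in> Q \<rightarrow>\<^sub>M count_space UNIV"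
proof -
  have "K v \<in> Q \<rightarrow>\<^sub>M count_space UNIV"
    if "parents_later (pa V E r) r js" "set js \<subseteq> V" "v \<in> set js" for js v
    using that
  proof (induction js arbitrary: v)
    case (Cons j js)
    show ?case
    proof (cases "v \<in> set js")
      case False
      then have v: "v = j" "v \<in> V" using Cons.prems by auto
      show ?thesis
      proof (cases "v = r")
        case True
        have "L r \<in> Q \<rightarrow>\<^sub>M count_space UNIV" using source_measurable[of "Inl r"] r by auto
        then show ?thesis unfolding True by (subst measurable_cong[OF K_root])
      next
        case False
        have "K (pa V E r v) \<in> Q \<rightarrow>\<^sub>M count_space UNIV" using Cons v False by auto
        moreover have "I v i \<in> Q \<rightarrow>\<^sub>M count_space UNIV" for i
          using source_measurable[of "Inr (v, i)"] v False by auto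
        moreover have "L v \<in> Q \<rightarrow>\<^sub>M count_space UNIV" using source_measurable[of "Inl v"] v by auto
        ultimately show ?thesis
          by (subst measurable_cong[OF K_step[OF _ v(2) False]])
            (auto intro: measurable_add_nat measurable_thin)
      qed
    qed (use Cons in auto)
  qed simp
  then show ?thesis using vertex_order[OF tree r] assms by blast
qed

text \<open>The variables that determine the count at \<open>v\<close> if the parent of \<open>v\<close> has the value prescribed
by \<open>n\<close>. For fixed \<open>n\<close>, these sets of variables are fixed and disjoint for different \<open>v\<close>.\<close>

definition block :: "('v \<Rightarrow> nat) \<Rightarrow> 'v \<Rightarrow> ('v + 'v \<times> nat) set" where
  "block n v = insert (Inl v) (if v = r then {} else Inr ` ({v} \<times> {1..n (pa V E r v)}))"

lemma block_sum: "(\<Sum>x\<in>block n v. source x \<omega>)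
    = L v \<omega> + (if v = r then 0 else \<Sum>i=1..n (pa V E r v). I v i \<omega>)"
proof -
  have "(\<Sum>x\<in>Inr ` ({v} \<times> {1..m}). source x \<omega>) = (\<Sum>i=1..m. I v i \<omega>)" for m
  proof -
    have "Inr ` ({v} \<times> {1..m}) = (\<lambda>i. Inr (v, i) :: 'v + 'v \<times> nat) ` {1..m}" by auto
    then show ?thesis by (simp add: sum.reindex inj_on_def)
  qed
  moreover have "(\<Sum>x\<in>insert (Inl v) (Inr ` ({v} \<times> {1..m})). source x \<omega>)
      = L v \<omega> + (\<Sum>x\<in>Inr ` ({v} \<times> {1..m}). source x \<omega>)" for m
    by (subst sum.insert) auto
  ultimately show ?thesis by (simp only: block_def split: if_split) simp
qed

text \<open>On the event that all counts are as prescribed by \<open>n\<close>, the random number of thinning variables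
used at \<open>v\<close> is \<open>n (pa V E r v)\<close>. So the recursively defined counts can be exchanged for sums
over the disjoint blocks, to which independence applies directly.\<close>

lemma construction_event:
  assumes \<omega>: "\<omega> \<in> space Q"
  shows "(\<forall>v\<in>V. K v \<omega> = n v) \<longleftrightarrow> (\<forall>v\<in>V. (\<Sum>x\<in>block n v. source x \<omega>) = n v)"
proof
  assume n: "\<forall>v\<in>V. K v \<omega> = n v"
  show "\<forall>v\<in>V. (\<Sum>x\<in>block n v. source x \<omega>) = n v"
  proof
    fix v assume v: "v \<in> V"
    show "(\<Sum>x\<in>block n v. source x \<omega>) = n v"
    proof (cases "v = r")
      case True
      then show ?thesis using K_root[OF \<omega>] n v by (simp add: block_sum)
    next
      case False
      then show ?thesis
        using K_step[OF \<omega> v False] parent_child(2)[OF tree r v False] n v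
        by (simp add: block_sum thin_def)
    qed
  qed
next
  assume n: "\<forall>v\<in>V. (\<Sum>x\<in>block n v. source x \<omega>) = n v"
  have "K v \<omega> = n v" if "parents_later (pa V E r) r js" "set js \<subseteq> V" "v \<in> set js" for js v
    using that
  proof (induction js arbitrary: v)
    case (Cons j js)
    show ?case
    proof (cases "v \<in> set js")
      case False
      then have v: "v = j" "v \<in> V" using Cons.prems by auto
      show ?thesis
      proof (cases "v = r")
        case True
        then show ?thesis using K_root[OF \<omega>] n r by (auto simp: block_sum)
      next
        case False
        then have "K (pa V E r v) \<omega> = n (pa V E r v)" using Cons v by auto
        then show ?thesis using K_step[OF \<omega> v(2) False] n v False by (auto simp: block_sum thin_def)
      qed
    qed (use Cons in auto)
  qed simp
  then show "\<forall>v\<in>V. K v \<omega> = n v" using vertex_order[OF tree r] by blast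
qed

lemma block_law:
  assumes v: "v \<in> V"
  shows "distr Q (count_space UNIV) (\<lambda>\<omega>. \<Sum>x\<in>block n v. source x \<omega>)
    = measure_pmf (thinning_step l (edge_weight V E a r v) (n (pa V E r v)))"
proof -
  define b where "b = edge_weight V E a r v"
  have b: "b \<in> {0..1}" unfolding b_def by (rule edge_weight_bounds[OF tree r a v])
  let ?p = "case_sum (\<lambda>_::'v. poisson0_pmf (l * (1 - b)))
    (\<lambda>_::'v \<times> nat. map_pmf of_bool (bernoulli_pmf b))"
  have "indep_vars (\<lambda>_. count_space UNIV) source (block n v)"
    by (rule indep_vars_subset[OF indep_source]) (use v in \<open>auto simp: block_def\<close>)
  moreover have "finite (block n v)" by (auto simp: block_def)
  moreover have "distr Q (count_space UNIV) (source x) = measure_pmf (?p x)" if x: "x \<in> block n v" for x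
    using C v x by (auto simp: block_def mpmrf_construction_def b_def edge_weight_def split: if_splits)
  moreover have "pgf (thinning_step l b (n (pa V E r v))) t = (\<Prod>x\<in>block n v. pgf (?p x) t)"
    if t: "t \<in> {-1..1}" for t
  proof -
    have "0 \<le> l * (1 - b)" using l b by simp
    moreover have "(\<Prod>x\<in>Inr ` ({v} \<times> {1..m}). pgf (?p x) t) = (1 - b + b * t) ^ m" for m
    proof -
      have "Inr ` ({v} \<times> {1..m}) = (\<lambda>i. Inr (v, i) :: 'v + 'v \<times> nat) ` {1..m}" by auto
      then show ?thesis using b by (simp add: prod.reindex inj_on_def pgf_bernoulli)
    qed
    moreover have "(\<Prod>x\<in>insert (Inl v) (Inr ` ({v} \<times> {1..m})). pgf (?p x) t)
        = pgf (poisson0_pmf (l * (1 - b))) t * (\<Prod>x\<in>Inr ` ({v} \<times> {1..m}). pgf (?p x) t)" for m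
      by (subst prod.insert) auto
    moreover have "b = 0" if "v = r" using that by (simp add: b_def edge_weight_def)
    ultimately show ?thesis
      using l b t by (cases "v = r") (simp_all only: block_def pgf_thinning_step pgf_poisson if_True if_False, simp add: pgf_poisson)
  qed
  ultimately show ?thesis unfolding b_def[symmetric] by (rule indep_sum_law)
qed

lemma construction_atoms:
  "measure Q {\<omega> \<in> space Q. \<forall>v\<in>V. K v \<omega> = n v}
    = (\<Prod>v\<in>V. pmf (thinning_step l (edge_weight V E a r v) (n (pa V E r v))) (n v))"
proof -
  let ?W = "\<lambda>v \<omega>. \<Sum>x\<in>block n v. source x \<omega>"
  have "indep_vars (\<lambda>v. PiM (block n v) (\<lambda>_. count_space UNIV)) (\<lambda>v \<omega>. restrict (\<lambda>x. source x \<omega>) (block n v)) V"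
    by (rule indep_vars_restrict[OF indep_source])
      (auto simp: block_def disjoint_family_on_def split: if_splits)
  then have "indep_vars (\<lambda>_. count_space UNIV)
      (\<lambda>v \<omega>. \<Sum>x\<in>block n v. restrict (\<lambda>x. source x \<omega>) (block n v) x) V"
    by (rule indep_vars_compose2) (intro measurable_sum_nat measurable_component_singleton)
  then have ind: "indep_vars (\<lambda>_. count_space UNIV) ?W V" by simp
  have W: "?W v \<in> Q \<rightarrow>\<^sub>M count_space UNIV" if "v \<in> V" for v
    using ind that by (simp add: indep_vars_def)
  have "{\<omega> \<in> space Q. \<forall>v\<in>V. K v \<omega> = n v} = (\<Inter>v\<in>V. ?W v -` {n v} \<inter> space Q)"
    using construction_event r by auto
  also have "measure Q \<dots> = (\<Prod>v\<in>V. measure Q (?W v -` {n v} \<inter> space Q))"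
    using r tree_finite[OF tree] by (intro indep_varsD_finite[OF ind]) auto
  also have "\<dots> = (\<Prod>v\<in>V. pmf (thinning_step l (edge_weight V E a r v) (n (pa V E r v))) (n v))"
  proof (rule prod.cong[OF refl])
    fix v assume v: "v \<in> V"
    have "measure Q (?W v -` {n v} \<inter> space Q) = measure (distr Q (count_space UNIV) (?W v)) {n v}"
      using W[OF v] by (simp add: measure_distr)
    also have "\<dots> = pmf (thinning_step l (edge_weight V E a r v) (n (pa V E r v))) (n v)"
      unfolding block_law[OF v] by (simp add: measure_pmf_single)
    finally show "measure Q (?W v -` {n v} \<inter> space Q) = \<dots>" .
  qed
  finally show ?thesis .
qed

end

section \<open>The law of the total\<close>

text \<open>Only finitely many vectors of natural numbers have a given sum, so the probabilities of single
vectors determine the law of the sum by finite additivity.\<close>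

lemma sum_law:
  fixes N :: "'v \<Rightarrow> 'a \<Rightarrow> nat" and p :: "('v \<Rightarrow> nat) pmf"
  assumes P: "prob_space P" and V: "finite V"
    and N: "\<And>v. v \<in> V \<Longrightarrow> N v \<in> P \<rightarrow>\<^sub>M count_space UNIV"
    and ext: "set_pmf p \<subseteq> extensional V"
    and atoms: "\<And>n. n \<in> extensional V \<Longrightarrow> measure P {\<omega> \<in> space P. \<forall>v\<in>V. N v \<omega> = n v} = pmf p n"
  shows "distr P (count_space UNIV) (\<lambda>\<omega>. \<Sum>v\<in>V. N v \<omega>) = measure_pmf (map_pmf (\<lambda>n. \<Sum>v\<in>V. n v) p)"
proof -
  interpret P: prob_space P by fact
  let ?M = "\<lambda>\<omega>. \<Sum>v\<in>V. N v \<omega>"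
  have M: "?M \<in> P \<rightarrow>\<^sub>M count_space UNIV" by (rule measurable_sum_nat) (rule N)
  obtain s where s: "distr P (count_space UNIV) ?M = measure_pmf s" using distr_nat_pmf[OF P M] .
  have "s = map_pmf (\<lambda>n. \<Sum>v\<in>V. n v) p"
  proof (rule pmf_eqI)
    fix m :: nat
    define A where "A = {n \<in> extensional V. (\<Sum>v\<in>V. n v) = m}"
    define B where "B n = {\<omega> \<in> space P. \<forall>v\<in>V. N v \<omega> = n v}" for n
    have "A \<subseteq> PiE V (\<lambda>_. {..m})"
    proof
      fix n assume n: "n \<in> A"
      then have "n v \<le> m" if "v \<in> V" for v using member_le_sum[of v V n] that V by (simp add: A_def)
      then show "n \<in> PiE V (\<lambda>_. {..m})" using n by (simp add: A_def PiE_iff)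
    qed
    moreover have "finite (PiE V (\<lambda>_. {..m}))" by (rule finite_PiE[OF V]) simp
    ultimately have A: "finite A" by (rule finite_subset)
    have B: "B n \<in> P.events" for n
    proof -
      have "{\<omega> \<in> space P. N v \<omega> = n v} \<in> P.events" if "v \<in> V" for v
        using measurable_sets[OF N[OF that], of "{n v}"] by (simp add: vimage_def Int_def conj_commute)
      then show ?thesis unfolding B_def using V by (intro sets.sets_Collect_finite_All) auto
    qed
    have disj: "disjoint_family_on B A"
    proof (unfold disjoint_family_on_def, intro ballI impI)
      fix n n' assume "n \<in> A" "n' \<in> A" "n \<noteq> n'"
      then obtain v where "v \<in> V" "n v \<noteq> n' v" using extensionalityI[of n V n'] by (auto simp: A_def)
      then show "B n \<inter> B n' = {}" by (auto simp: B_def)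
    qed
    have un: "?M -` {m} \<inter> space P = (\<Union>n\<in>A. B n)"
    proof
      show "?M -` {m} \<inter> space P \<subseteq> (\<Union>n\<in>A. B n)"
      proof
        fix \<omega> assume "\<omega> \<in> ?M -` {m} \<inter> space P"
        then have "restrict (\<lambda>v. N v \<omega>) V \<in> A" "\<omega> \<in> B (restrict (\<lambda>v. N v \<omega>) V)"
          by (auto simp: A_def B_def)
        then show "\<omega> \<in> (\<Union>n\<in>A. B n)" by blast
      qed
    qed (auto simp: A_def B_def)
    have "pmf s m = measure (distr P (count_space UNIV) ?M) {m}" unfolding s by (simp add: measure_pmf_single)
    also have "\<dots> = measure P (\<Union>n\<in>A. B n)" using M un by (simp add: measure_distr)
    also have "\<dots> = (\<Sum>n\<in>A. measure P (B n))"
      by (rule P.finite_measure_finite_Union) (use A B disj in auto)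
    also have "\<dots> = (\<Sum>n\<in>A. pmf p n)" using atoms by (intro sum.cong) (auto simp: A_def B_def)
    also have "\<dots> = measure_pmf.prob p A" using A by (simp add: measure_measure_pmf_finite)
    also have "\<dots> = measure_pmf.prob p ((\<lambda>n. \<Sum>v\<in>V. n v) -` {m})"
      using ext by (intro measure_pmf.finite_measure_eq_AE) (auto simp: A_def AE_measure_pmf_iff)
    also have "\<dots> = pmf (map_pmf (\<lambda>n. \<Sum>v\<in>V. n v) p) m" by (simp add: pmf_map)
    finally show "pmf s m = pmf (map_pmf (\<lambda>n. \<Sum>v\<in>V. n v) p) m" .
  qed
  then show ?thesis using s by simp
qed

lemma vector_law_atom:
  fixes N :: "'v \<Rightarrow> 'a \<Rightarrow> nat"
  assumes V: "finite V" and N: "\<And>v. v \<in> V \<Longrightarrow> N v \<in> P \<rightarrow>\<^sub>M count_space UNIV" and n: "n \<in> extensional V"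
  shows "measure P {\<omega> \<in> space P. \<forall>v\<in>V. N v \<omega> = n v} = measure (vector_law P V N) {n}"
proof -
  have "PiE V (\<lambda>v. {n v}) = {n}" using n by (rule PiE_singleton)
  moreover have "PiE V (\<lambda>v. {n v}) \<in> sets (\<Pi>\<^sub>M v\<in>V. count_space UNIV)"
    by (rule sets_PiM_I_finite[OF V]) auto
  moreover have "(\<lambda>\<omega>. \<lambda>v\<in>V. N v \<omega>) \<in> P \<rightarrow>\<^sub>M (\<Pi>\<^sub>M v\<in>V. count_space UNIV)"
    by (rule measurable_restrict) (rule N)
  moreover have "(\<lambda>\<omega>. \<lambda>v\<in>V. N v \<omega>) -` {n} \<inter> space P = {\<omega> \<in> space P. \<forall>v\<in>V. N v \<omega> = n v}"
    using n by (auto simp: fun_eq_iff extensional_def)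
  ultimately show ?thesis unfolding vector_law_def by (simp add: measure_distr)
qed

lemma cluster_gf_edge_weight:
  assumes tree: "is_tree V E" and r: "r \<in> V"
  shows "cluster_gf V E a r t = (\<Sum>v\<in>V. (1 - edge_weight V E a r v) * eta V E a r v t)"
proof -
  let ?g = "\<lambda>j. (1 - edge_weight V E a r j) * eta V E a r j t"
  have fin: "finite V" using tree_finite[OF tree] .
  have "(\<Sum>j\<in>ch V E r i. (1 - a {i, j}) * eta V E a r j t) = (\<Sum>j\<in>{j \<in> V - {r}. pa V E r j = i}. ?g j)" for i
    unfolding ch_eq_parent[OF tree r] by (rule sum.cong) (auto simp: edge_weight_def)
  then have "(\<Sum>i\<in>V. \<Sum>j\<in>ch V E r i. (1 - a {i, j}) * eta V E a r j t)
      = (\<Sum>i\<in>V. \<Sum>j\<in>{j \<in> V - {r}. pa V E r j = i}. ?g j)" by simp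
  also have "\<dots> = (\<Sum>j\<in>V - {r}. ?g j)"
    using fin parent_child(2)[OF tree r] by (intro sum.group) auto
  finally show ?thesis
    unfolding cluster_gf_def using fin r by (simp add: sum.remove[of V r] edge_weight_def)
qed

text \<open>The root \<open>s\<close> used to compute the cluster-size function is arbitrary and need not be the
root of the construction.\<close>

lemma MPMRF_total_law:
  fixes N :: "'v \<Rightarrow> 'a \<Rightarrow> nat"
  assumes tree: "is_tree V E" and l: "0 \<le> l" and a: "\<And>e. e \<in> E \<Longrightarrow> a e \<in> {0..1}"
    and N: "is_MPMRF P V E l a N" and s: "s \<in> V"
  shows "\<exists>p. distr P (count_space UNIV) (\<lambda>\<omega>. \<Sum>v\<in>V. N v \<omega>) = measure_pmf p
    \<and> (\<forall>t\<in>{-1..1}. pgf p t = exp (l * (cluster_gf V E a s t - cluster_gf V E a s 1)))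
    \<and> (\<integral>\<^sup>+n. real n \<partial>measure_pmf p) = ennreal (real (card V) * l)"
proof -
  have fin: "finite V" using tree_finite[OF tree] .
  obtain r Q L I K where r: "r \<in> V" and C: "mpmrf_construction (Q :: ('v + 'v \<times> nat \<Rightarrow> nat) measure) V E l a r L I K"
    and law: "vector_law P V N = vector_law Q V K" and P: "prob_space P"
    and Nm: "\<And>v. v \<in> V \<Longrightarrow> N v \<in> P \<rightarrow>\<^sub>M count_space UNIV"
    using N unfolding is_MPMRF_def by blast
  define \<beta> where "\<beta> = edge_weight V E a r"
  define \<kappa> where "\<kappa> v = thinning_step l (\<beta> v)" for v
  have \<beta>: "\<beta> v \<in> {0..1}" if "v \<in> V" for v
    unfolding \<beta>_def by (rule edge_weight_bounds[OF tree r a that])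
  have \<beta>r: "\<beta> r = 0" by (simp add: \<beta>_def edge_weight_def)
  obtain js where js: "set js = V" "parents_later (pa V E r) r js" using vertex_order[OF tree r] .
  define q where "q = tree_law (pa V E r) \<kappa> js"
  have ext: "set_pmf q \<subseteq> extensional V" using set_tree_law js unfolding q_def by blast
  have atoms: "measure P {\<omega> \<in> space P. \<forall>v\<in>V. N v \<omega> = n v} = pmf q n" if n: "n \<in> extensional V" for n
  proof -
    have "measure P {\<omega> \<in> space P. \<forall>v\<in>V. N v \<omega> = n v} = measure (vector_law Q V K) {n}"
      unfolding law[symmetric] by (rule vector_law_atom[OF fin Nm n])
    also have "\<dots> = measure Q {\<omega> \<in> space Q. \<forall>v\<in>V. K v \<omega> = n v}"
      using construction_measurable[OF tree r l a C] by (intro vector_law_atom[OF fin _ n, symmetric])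
    also have "\<dots> = (\<Prod>v\<in>V. pmf (\<kappa> v (n (pa V E r v))) (n v))"
      unfolding \<kappa>_def \<beta>_def by (rule construction_atoms[OF tree r l a C])
    also have "\<dots> = pmf q n"
    proof -
      have "\<kappa> r i = \<kappa> r k" for i k unfolding \<kappa>_def \<beta>r by (rule thinning_step_0[OF l])
      with js(2) n js(1) have "pmf q n = (\<Prod>v\<in>set js. pmf (\<kappa> v (n (pa V E r v))) (n v))"
        unfolding q_def by (intro pmf_tree_law) auto
      then show ?thesis by (simp only: js(1))
    qed
    finally show ?thesis .
  qed
  define p where "p = map_pmf (\<lambda>n. \<Sum>v\<in>V. n v) q"
  have total: "distr P (count_space UNIV) (\<lambda>\<omega>. \<Sum>v\<in>V. N v \<omega>) = measure_pmf p"
    unfolding p_def by (rule sum_law[OF P fin Nm ext atoms])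
  have gf: "pgf p t = exp (l * (cluster_gf V E a s t - cluster_gf V E a s 1))" if t: "t \<in> {-1..1}" for t
  proof -
    have ch: "j \<in> ch V E r v \<longleftrightarrow> j \<in> V - {r} \<and> pa V E r j = v" for j v
      by (simp add: ch_eq_parent[OF tree r])
    have \<eta>: "eta V E a r v t = t * (\<Prod>j\<in>ch V E r v. 1 - \<beta> j + \<beta> j * eta V E a r j t)" for v
      using tree by (subst eta.simps) (auto simp: ch \<beta>_def edge_weight_def intro!: prod.cong)
    have \<eta>_bd: "eta V E a r v t \<in> {-1..1}" for v
    proof -
      obtain h where "\<forall>t\<in>{-1..1}. eta V E a r v t = pgf h t" using eta_pgf[of V E a r v] tree a by blast
      then show ?thesis using pgf_bounded[OF t, of h] t by simp
    qed
    have "pgf p t = measure_pmf.expectation q (\<lambda>n. \<Prod>v\<in>V. t ^ n v)"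
      by (simp add: pgf_def p_def power_sum)
    also have "\<dots> = measure_pmf.expectation q (\<lambda>n. \<Prod>v\<in>set js.
        (t * (\<Prod>j\<in>ch V E r v - set js. 1 - \<beta> j + \<beta> j * eta V E a r j t)) ^ n v)"
    proof -
      have empty: "ch V E r v - V = {}" for v using ch_subset[of V E r v] by auto
      show ?thesis unfolding js(1) empty by simp
    qed
    also have "\<dots> = (\<Prod>v\<in>set js. exp (l * (1 - \<beta> v) * (eta V E a r v t - 1)))"
      unfolding q_def
    proof (rule expectation_tree_law[where S = V and rate = "\<lambda>v. l * (1 - \<beta> v)"])
      show "pgf (\<kappa> v k) x = exp (l * (1 - \<beta> v) * (x - 1)) * (1 - \<beta> v + \<beta> v * x) ^ k"
        if "v \<in> V" "x \<in> {-1..1}" for v k x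
        unfolding \<kappa>_def by (rule pgf_thinning_step[OF l \<beta>[OF that(1)] that(2)])
      show "eta V E a r v t \<in> {-1..1}" for v by (rule \<eta>_bd)
      show "\<beta> v \<in> {0..1}" if "v \<in> V" for v by (rule \<beta>[OF that])
      show "eta V E a r v t = t * (\<Prod>j\<in>ch V E r v. 1 - \<beta> j + \<beta> j * eta V E a r j t)" for v by (rule \<eta>)
      show "j \<in> ch V E r v \<longleftrightarrow> j \<in> V - {r} \<and> pa V E r j = v" for v j by (rule ch)
      show "set js \<subseteq> V" by (simp add: js(1))
    qed (rule t \<beta>r fin js(2))+
    also have "\<dots> = exp (\<Sum>v\<in>V. l * (1 - \<beta> v) * (eta V E a r v t - 1))"
      using fin by (simp add: exp_sum js(1))
    also have "(\<Sum>v\<in>V. l * (1 - \<beta> v) * (eta V E a r v t - 1)) = l * (cluster_gf V E a r t - cluster_gf V E a r 1)"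
      unfolding cluster_gf_edge_weight[OF tree r] eta_1[OF tree] sum_subtractf[symmetric] sum_distrib_left
      by (rule sum.cong) (simp_all add: \<beta>_def algebra_simps)
    finally show ?thesis unfolding cluster_gf_root[OF tree r s] .
  qed
  have mean: "(\<integral>\<^sup>+n. real n \<partial>measure_pmf p) = ennreal (real (card V) * l)"
  proof -
    have "(\<integral>\<^sup>+n. real n \<partial>measure_pmf p) = (\<Sum>v\<in>V. \<integral>\<^sup>+n. real (n v) \<partial>measure_pmf q)"
      by (simp add: p_def sum_ennreal[symmetric] nn_integral_sum del: sum_ennreal)
    also have "\<dots> = (\<Sum>v\<in>V. ennreal l)"
    proof (rule sum.cong[OF refl])
      fix v assume "v \<in> V"
      then show "(\<integral>\<^sup>+n. real (n v) \<partial>measure_pmf q) = ennreal l"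
        unfolding q_def using \<beta> mean_thinning_step[OF l \<beta>]
        by (intro mean_tree_law[where \<beta> = \<beta> and r = r])
          (simp_all add: js \<beta>r l \<kappa>_def del: atLeastAtMost_iff)
    qed
    also have "\<dots> = ennreal (real (card V) * l)"
      using l by (simp add: ennreal_mult ennreal_of_nat_eq_real_of_nat)
    finally show ?thesis .
  qed
  show ?thesis by (intro exI[of _ p] conjI ballI total gf mean)
qed

section \<open>Moving a branch\<close>

lemma path_stays:
  assumes "successively (\<lambda>b c. {b, c} \<in> E) p" "p \<noteq> []" "hd p \<in> A"
    and "\<And>b c. {b, c} \<in> E \<Longrightarrow> b \<in> A \<Longrightarrow> c \<in> A"
  shows "set p \<subseteq> A"
  using assms(1-3)
proof (induction p rule: induct_list012)
  case (3 x y zs)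
  then show ?case using assms(4)[of x y] by auto
qed auto

text \<open>The new neighbour \<open>w\<close> of \<open>u\<close> is not in the moved branch: otherwise no edge of the new tree would
leave the branch, and there would be no path from \<open>u\<close> to \<open>v\<close>.\<close>

lemma reattached_tree:
  assumes T: "joined_trees V1 V2 V E1 E2 E v u" and tree': "is_tree V E'"
    and E': "E' = insert {w, u} (E1 \<union> E2)" and w: "w \<in> V"
  shows "joined_trees V1 V2 V E1 E2 E' w u"
proof -
  interpret joined_trees V1 V2 V E1 E2 E v u by fact
  have "w \<notin> V2"
  proof
    assume "w \<in> V2"
    obtain p where p: "is_path V E' u p v" using tree_path_exists[OF tree'] r s V by blast
    have "set p \<subseteq> V2"
    proof (rule path_stays)
      fix b c assume bc: "{b, c} \<in> E'" "b \<in> V2"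
      then have "{b, c} \<notin> E1" using tree_edge[OF tree1] disj by blast
      with bc show "c \<in> V2"
        using tree_edge[OF tree2, of b c] \<open>w \<in> V2\<close> s by (auto simp: E' doubleton_eq_iff)
    qed (use p s in \<open>auto simp: is_path_def\<close>)
    then show False using is_path_ends[OF p] r disj by blast
  qed
  then show ?thesis using tree' tree1 tree2 disj s V w by unfold_locales (auto simp: E')
qed

text \<open>Both totals are compound Poisson with the same rate \<open>l * c\<close>, since \<open>\<Phi>' - \<Phi>\<close>
vanishes at 1. So only the jump laws \<open>j\<close> and \<open>j'\<close> have to be compared.\<close>

lemma stop_loss_le_move_branch:
  fixes a a' :: "'v set \<Rightarrow> real"
  assumes T: "joined_trees V1 V2 V E1 E2 E v u" and T': "joined_trees V1 V2 V E1 E2 E' w u"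
    and a: "\<And>e. e \<in> E \<Longrightarrow> a e \<in> {0..1}" and a': "\<And>e. e \<in> E' \<Longrightarrow> a' e \<in> {0..1}"
    and same: "\<And>e. e \<in> E1 \<union> E2 \<Longrightarrow> a' e = a e" and moved: "a' {w, u} = a {v, u}"
    and hv: "\<And>t. t \<in> {-1..1} \<Longrightarrow> pgf hv t = eta V1 E1 a v v t"
    and hw: "\<And>t. t \<in> {-1..1} \<Longrightarrow> pgf hw t = eta V1 E1 a w w t"
    and st: "\<And>k. measure_pmf.prob hv {k<..} \<le> measure_pmf.prob hw {k<..}"
    and l: "0 < l"
    and m: "\<And>t. t \<in> {-1..1} \<Longrightarrow> pgf m t = exp (l * (cluster_gf V E a v t - cluster_gf V E a v 1))"
    and m': "\<And>t. t \<in> {-1..1} \<Longrightarrow> pgf m' t = exp (l * (cluster_gf V E' a' w t - cluster_gf V E' a' w 1))"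
  shows "stop_loss_le m m'"
proof -
  interpret T: joined_trees V1 V2 V E1 E2 E v u by fact
  interpret T': joined_trees V1 V2 V E1 E2 E' w u by fact
  let ?\<alpha> = "a {v, u}"
  let ?y = "\<lambda>t. eta V2 E2 a u u t"
  have eta': "eta V1 E1 a' x z t = eta V1 E1 a x z t" "eta V2 E2 a' x z t = eta V2 E2 a x z t" for x z t
    by (rule eta_cong; use same in simp)+
  have gf': "cluster_gf V1 E1 a' x t = cluster_gf V1 E1 a x t" "cluster_gf V2 E2 a' x t = cluster_gf V2 E2 a x t" for x t
    by (rule cluster_gf_cong; use same in simp)+
  have wv: "cluster_gf V1 E1 a w t = cluster_gf V1 E1 a v t" for t
    by (rule cluster_gf_root[OF T.tree1 T'.r T.r])
  have diff: "cluster_gf V E' a' w t - cluster_gf V E a v t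
      = ?\<alpha> * ((?y t - 1) * (eta V1 E1 a w w t - eta V1 E1 a v v t))" for t
    unfolding T.cluster_gf_joined T'.cluster_gf_joined eta' gf' wv moved by (simp add: algebra_simps)
  define c where "c = cluster_gf V E a v 1"
  have c': "cluster_gf V E' a' w 1 = c" using diff[of 1] by (simp add: c_def eta_1[OF T.tree2])
  have c: "0 < c" unfolding c_def using T.tree a by (rule cluster_gf_pos)
  have "\<exists>j. \<forall>t\<in>{-1..1}. cluster_gf V E a v t = c * pgf j t"
    unfolding c_def using T.tree a by (rule cluster_gf_pgf)
  then obtain j where j: "\<forall>t\<in>{-1..1}. cluster_gf V E a v t = c * pgf j t" by blast
  have "\<exists>j. \<forall>t\<in>{-1..1}. cluster_gf V E' a' w t = cluster_gf V E' a' w 1 * pgf j t"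
    using T'.tree a' by (rule cluster_gf_pgf)
  then obtain j' where j': "\<forall>t\<in>{-1..1}. cluster_gf V E' a' w t = c * pgf j' t" unfolding c' by blast
  have "\<exists>y. \<forall>t\<in>{-1..1}. ?y t = pgf y t"
    using T.tree2 by (rule eta_pgf) (use a T.E in blast)
  then obtain y where y: "\<forall>t\<in>{-1..1}. ?y t = pgf y t" by blast
  have "stop_loss_le j j'"
  proof (rule stop_loss_le_pgf_swap[OF c _ st])
    have "{v, u} \<in> E" by (simp add: T.E)
    from a[OF this] show "0 \<le> ?\<alpha>" by simp
    fix t :: real assume t: "t \<in> {-1..1}"
    show "c * (pgf j' t - pgf j t) = ?\<alpha> * ((pgf y t - 1) * (pgf hw t - pgf hv t))"
      using diff[of t] bspec[OF j t] bspec[OF j' t] bspec[OF y t] hv[OF t] hw[OF t]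
      by (simp only: right_diff_distrib)
  qed
  moreover have "m = compound_poisson (l * c) j"
    by (rule pmf_eq_pgfI) (use l c m j in \<open>simp add: pgf_compound_poisson c_def[symmetric] algebra_simps\<close>)
  moreover have "m' = compound_poisson (l * c) j'"
    by (rule pmf_eq_pgfI) (use l c m' c' j' in \<open>simp add: pgf_compound_poisson algebra_simps\<close>)
  ultimately show ?thesis by (simp add: stop_loss_le_compound_poisson)
qed

lemma mean_pmf:
  assumes "(\<integral>\<^sup>+n. real n \<partial>measure_pmf p) = ennreal c" "0 \<le> c"
  shows "integrable (measure_pmf p) real" "measure_pmf.expectation p real = c"
  using nn_integral_eq_integrable[of real "measure_pmf p" c] assms by auto

lemma cx_le_pmf:
  assumes p: "distr P (count_space UNIV) X = measure_pmf p" and X: "X \<in> P \<rightarrow>\<^sub>M count_space UNIV"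
    and q: "distr Q (count_space UNIV) Y = measure_pmf q" and Y: "Y \<in> Q \<rightarrow>\<^sub>M count_space UNIV"
    and sl: "stop_loss_le p q" and c: "0 \<le> c"
    and means: "(\<integral>\<^sup>+n. real n \<partial>measure_pmf p) = ennreal c" "(\<integral>\<^sup>+n. real n \<partial>measure_pmf q) = ennreal c"
  shows "cx_le P (\<lambda>\<omega>. real (X \<omega>)) Q (\<lambda>\<omega>. real (Y \<omega>))"
  unfolding cx_le_def
proof (intro allI impI)
  fix \<phi> :: "real \<Rightarrow> real"
  assume \<phi>: "convex_on UNIV \<phi>" and "integrable P (\<lambda>\<omega>. \<phi> (real (X \<omega>)))" "integrable Q (\<lambda>\<omega>. \<phi> (real (Y \<omega>)))"
  then have "integrable p (\<lambda>n. \<phi> (real n))" "integrable q (\<lambda>n. \<phi> (real n))"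
    unfolding p[symmetric] q[symmetric] using X Y by (simp_all add: integrable_distr_eq)
  then have "measure_pmf.expectation p (\<lambda>n. \<phi> (real n)) \<le> measure_pmf.expectation q (\<lambda>n. \<phi> (real n))"
    using sl \<phi> mean_pmf[OF means(1) c] mean_pmf[OF means(2) c] by (intro convex_expectation_le) auto
  then show "(\<integral>\<omega>. \<phi> (real (X \<omega>)) \<partial>P) \<le> (\<integral>\<omega>. \<phi> (real (Y \<omega>)) \<partial>Q)"
    unfolding p[symmetric] q[symmetric] using X Y by (simp add: integral_distr)
qed

theorem theorem3:
  fixes V :: "'v set" and E E' :: "'v set set" and u v w :: 'v
    and l :: real and a a' :: "'v set \<Rightarrow> real"
    and P :: "'a measure" and N :: "'v \<Rightarrow> 'a \<Rightarrow> nat"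
    and P' :: "'b measure" and N' :: "'v \<Rightarrow> 'b \<Rightarrow> nat"
    and Q :: "'c measure" and H\<^sub>v :: "'c \<Rightarrow> nat"
    and Q' :: "'d measure" and H\<^sub>w :: "'d \<Rightarrow> nat"
    and Vd Vs :: "'v set" and Ed Es :: "'v set set"
  assumes "is_tree V E" and "is_tree V E'"
    and "u \<in> V" and "v \<in> V" and "w \<in> V"
    and "{u, v} \<in> E" and "{u, w} \<in> E'"
    and "E - {{u, v}} = E' - {{u, w}}"
    and "l > 0"
    and "\<forall>e\<in>E. a e \<in> {0..1}" and "\<forall>e\<in>E'. a' e \<in> {0..1}"
    and "\<forall>e\<in>E - {{u, v}}. a e = a' e" and "a {u, v} = a' {u, w}"
    and "is_MPMRF P V E l a N" and "is_MPMRF P' V E' l a' N'"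
    and "Vd = {u} \<union> dsc V E v u"
    and "Ed = {{i, j} | i j. {i, j} \<in> E \<and> i \<in> Vd \<and> j \<in> Vd}"
    and "Vs = V - Vd"
    and "Es = E - ({{u, v}} \<union> Ed)"
    and "has_pgf Q H\<^sub>v (\<lambda>t. eta Vs Es a v v t)"
    and "has_pgf Q' H\<^sub>w (\<lambda>t. eta Vs Es a w w t)"
    and "st_le Q (\<lambda>\<omega>. real (H\<^sub>v \<omega>)) Q' (\<lambda>\<omega>. real (H\<^sub>w \<omega>))"
  shows "cx_le P (\<lambda>\<omega>. real (\<Sum>j\<in>V. N j \<omega>)) P' (\<lambda>\<omega>. real (\<Sum>j\<in>V. N' j \<omega>))"
proof -
  have vu: "{v, u} \<in> E" using assms(6) by (simp add: insert_commute)
  define E1 where "E1 = {e \<in> E. e \<subseteq> Vs}"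
  define E2 where "E2 = {e \<in> E. e \<subseteq> Vd}"
  \<comment> \<open>The residual tree and the moved branch are the two sides of the edge between \<open>v\<close> and \<open>u\<close>.\<close>
  have cut: "joined_trees Vs Vd V E1 E2 E v u"
    unfolding E1_def E2_def assms(18) unfolding assms(16) by (rule cut_edge[OF assms(1) vu])
  interpret cut: joined_trees Vs Vd V E1 E2 E v u by (rule cut)
  have "\<forall>e\<in>E. \<exists>i\<in>V. \<exists>j\<in>V. i \<noteq> j \<and> e = {i, j}" using assms(1) by (simp add: is_tree_def)
  then have pair: "\<exists>i j. e = {i, j}" if "e \<in> E" for e using that by blast
  have Ed: "Ed = E2"
    unfolding assms(17) E2_def using pair by fastforce
  have disj: "E1 \<inter> E2 = {}"
    using pair cut.disj by (fastforce simp: E1_def E2_def)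
  have vu_notin: "{v, u} \<notin> E1 \<union> E2"
    using cut.disj cut.r cut.s by (auto simp: E1_def E2_def)
  have vu_uv: "{v, u} = {u, v}" by blast
  have Es: "Es = E1"
    unfolding assms(19) Ed using cut.E disj vu_notin unfolding vu_uv by blast
  have rest: "E - {{u, v}} = E1 \<union> E2"
    using cut.E vu_notin unfolding vu_uv by blast
  have "{w, u} = {u, w}" by blast
  then have E': "E' = insert {w, u} (E1 \<union> E2)" using assms(7,8) rest by auto
  have cut': "joined_trees Vs Vd V E1 E2 E' w u"
    by (rule reattached_tree[OF cut assms(2) E' assms(5)])
  have Hv: "prob_space Q" "H\<^sub>v \<in> Q \<rightarrow>\<^sub>M count_space UNIV"
    and Hw: "prob_space Q'" "H\<^sub>w \<in> Q' \<rightarrow>\<^sub>M count_space UNIV"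
    using assms(20,21) by (auto simp: has_pgf_def)
  obtain hv where hv: "distr Q (count_space UNIV) H\<^sub>v = measure_pmf hv" using distr_nat_pmf[OF Hv] .
  obtain hw where hw: "distr Q' (count_space UNIV) H\<^sub>w = measure_pmf hw" using distr_nat_pmf[OF Hw] .
  have hv_pgf: "pgf hv t = eta Vs E1 a v v t" and hw_pgf: "pgf hw t = eta Vs E1 a w w t"
    if "t \<in> {-1..1}" for t
    using assms(20,21) that pgf_distr[OF hv Hv(2)] pgf_distr[OF hw Hw(2)]
    by (auto simp: has_pgf_def Es)
  have st: "measure_pmf.prob hv {k<..} \<le> measure_pmf.prob hw {k<..}" for k
  proof -
    have "measure_pmf.prob hv {k<..} = measure Q {\<omega> \<in> space Q. real (H\<^sub>v \<omega>) > real k}"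
      unfolding hv[symmetric] using Hv(2)
      by (simp add: measure_distr) (intro arg_cong[where f = "measure Q"], auto)
    moreover have "measure_pmf.prob hw {k<..} = measure Q' {\<omega> \<in> space Q'. real (H\<^sub>w \<omega>) > real k}"
      unfolding hw[symmetric] using Hw(2)
      by (simp add: measure_distr) (intro arg_cong[where f = "measure Q'"], auto)
    ultimately show ?thesis using assms(22)[unfolded st_le_def, rule_format, of "real k"] by simp
  qed
  have a: "e \<in> E \<Longrightarrow> a e \<in> {0..1}" and a': "e \<in> E' \<Longrightarrow> a' e \<in> {0..1}" for e
    using assms(10,11) by auto
  have l: "0 \<le> l" using assms(9) by simp
  obtain m where m: "distr P (count_space UNIV) (\<lambda>\<omega>. \<Sum>j\<in>V. N j \<omega>) = measure_pmf m"
      "\<forall>t\<in>{-1..1}. pgf m t = exp (l * (cluster_gf V E a v t - cluster_gf V E a v 1))"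
      "(\<integral>\<^sup>+n. real n \<partial>measure_pmf m) = ennreal (real (card V) * l)"
    using MPMRF_total_law[OF assms(1) l _ assms(14,4)] assms(10) by blast
  obtain m' where m': "distr P' (count_space UNIV) (\<lambda>\<omega>. \<Sum>j\<in>V. N' j \<omega>) = measure_pmf m'"
      "\<forall>t\<in>{-1..1}. pgf m' t = exp (l * (cluster_gf V E' a' w t - cluster_gf V E' a' w 1))"
      "(\<integral>\<^sup>+n. real n \<partial>measure_pmf m') = ennreal (real (card V) * l)"
    using MPMRF_total_law[OF assms(2) l _ assms(15,5)] assms(11) by blast
  have sl: "stop_loss_le m m'"
  proof (rule stop_loss_le_move_branch[OF cut cut' a a' _ _ hv_pgf hw_pgf st assms(9) m(2)[rule_format] m'(2)[rule_format]])
    show "a' e = a e" if "e \<in> E1 \<union> E2" for e using assms(12) that rest by auto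
    show "a' {w, u} = a {v, u}" using assms(13) by (simp add: insert_commute)
  qed
  have "(\<lambda>\<omega>. \<Sum>j\<in>V. N j \<omega>) \<in> P \<rightarrow>\<^sub>M count_space UNIV"
    "(\<lambda>\<omega>. \<Sum>j\<in>V. N' j \<omega>) \<in> P' \<rightarrow>\<^sub>M count_space UNIV"
    using assms(14,15) unfolding is_MPMRF_def by (auto intro: measurable_sum_nat)
  from cx_le_pmf[OF m(1) this(1) m'(1) this(2) sl _ m(3) m'(3)] l show ?thesis by simp
qed

end
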